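(* Assume that $f_{\mathcal H}$ is $L$-smooth, that the honest local objectives satisfy the $(G,B)$-bounded dissimilarity condition, that the stochastic gradients satisfy the stochastic first-order oracle assumption with variance bound $\sigma^2$, that the aggregation rule $\mathcal A$ is $(b,\kappa)$-robust, and that $\kappa B^2<1/56$. Take constant stepsizes $\gamma_t\equiv\gamma$ with $0<\gamma L\le1/36$ and constant momentum parameters $\beta_t\equiv\beta=1-36\gamma L$. Then for every integer $T\ge1$ the iterates $\{x^t\}$ generated by R-DSGD-M satisfy $$\frac1T\sum_{t=0}^{T-1}\mathbb E\left[\|\nabla f_{\mathcal H}(x^t)\|^2\right]\le\frac{9\left(f_{\mathcal H}(x^0)-f_{\mathcal H}^*\right)}{4\left(\frac38-21\kappa B^2\right)\gamma T}+\frac{\frac{162L}{h}+756\kappa L}{\frac38-21\kappa B^2}\,\gamma\sigma^2+\frac{21\kappa G^2}{\frac38-21\kappa B^2}.$$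
   Context: Setting. There are $n$ workers and a central server; $b<n/2$ workers may be Byzantine. $\mathcal H\subset[n]=\{1,\dots,n\}$ is the set of honest workers, $|\mathcal H|=h=n-b$. Worker $i$ has data distribution $\mathcal D_i$ and, for a loss $\ell$, differentiable local objective $f_i(x)=\mathbb E_{\xi_i\sim\mathcal D_i}[\ell(x,\xi_i)]$, $x\in\mathbb R^d$. The global objective is $f_{\mathcal H}=\frac1h\sum_{i\in\mathcal H}f_i$, and $f_{\mathcal H}^*=\inf_{x\in\mathbb R^d}f_{\mathcal H}(x)>-\infty$. $\|\cdot\|$ is the Euclidean norm and $\mathbb E$ the total expectation. R-DSGD-M (robust distributed SGD with local momentum). Given a deterministic $x^0\in\mathbb R^d$, $m_i^0=0$ for $i\in\mathcal H$, stepsizes $\gamma_t>0$, momentum parameters $\beta_t\in[0,1]$ and an aggregation rule $\mathcal A:\mathbb R^{d\times n}\to\mathbb R^d$: for $t=1,2,\dots$, each honest worker $i\in\mathcal H$ computes a stochastic gradient $g_i^t=g_i(x^{t-1},\xi_i^t)$, where $\xi_i^t\sim\mathcal D_i$ is drawn afresh (independently of the past), and sends $m_i^t=\beta_tm_i^{t-1}+(1-\beta_t)g_i^t$; each Byzantine worker $j$ sends an arbitrary vector $m_j^t\in\mathbb R^d$; the server sets $x^t=x^{t-1}-\gamma_t\,\mathcal A(m_1^t,\dots,m_n^t)$. $L$-smoothness: $f_{\mathcal H}$ is differentiable and $\nabla f_{\mathcal H}$ is Lipschitz continuous with constant $L>0$. $(G,B)$-bounded dissimilarity ($G,B\ge0$):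 $\frac1h\sum_{i\in\mathcal H}\|\nabla f_i(x)-\nabla f_{\mathcal H}(x)\|^2\le G^2+B^2\|\nabla f_{\mathcal H}(x)\|^2$ for all $x\in\mathbb R^d$. Stochastic first-order oracle: for each $i\in\mathcal H$ and all $x$, $\mathbb E_{\xi_i\sim\mathcal D_i}[g_i(x,\xi_i)]=\nabla f_i(x)$ and $\mathbb E_{\xi_i\sim\mathcal D_i}[\|g_i(x,\xi_i)-\nabla f_i(x)\|^2]\le\sigma^2$; the stochastic gradients of different workers are mutually independent. $(b,\kappa)$-robustness ($\kappa>0$, $b<n/2$): for all $x_1,\dots,x_n\in\mathbb R^d$ and every $S\subset[n]$ with $|S|=n-b$, $\|\mathcal A(x_1,\dots,x_n)-\bar x_S\|^2\le\frac{\kappa}{n-b}\sum_{i\in S}\|x_i-\bar x_S\|^2$, where $\bar x_S=\frac1{n-b}\sum_{i\in S}x_i$. *)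

theory Defs
  imports "HOL-Probability.Probability"
begin

text \<open>
  Workers are the elements of a finite type \<open>'n\<close>, so \<open>n = CARD('n)\<close>; points of the parameter
  space are of type \<open>real ^ 'd\<close>, and the input of an aggregation rule (one vector per worker) is
  of type \<open>real ^ 'd ^ 'n\<close>. All data samples live in a common type \<open>'x\<close>.
\<close>

definition gradient :: "('a::real_inner \<Rightarrow> real) \<Rightarrow> 'a \<Rightarrow> 'a" where
  "gradient f x = (THE D. GDERIV f x :> D)"

lemma gradient_eqI:
  assumes "GDERIV f x :> D"
  shows "gradient f x = D"
  unfolding gradient_def
proof (rule the_equality)
  show "GDERIV f x :> D" by (rule assms)
next
  fix E assume "GDERIV f x :> E"
  then have "(\<lambda>h. inner h E) = (\<lambda>h. inner h D)"
    using assms unfolding gderiv_def by (rule has_derivative_unique)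
  then have "inner (E - D) E = inner (E - D) D" by (rule fun_cong)
  then have "inner (E - D) (E - D) = 0" by (simp add: inner_diff_right)
  then show "E = D" by simp
qed

lemma GDERIV_gradient:
  fixes f :: "'a::euclidean_space \<Rightarrow> real"
  assumes "f differentiable (at x)"
  shows "GDERIV f x :> gradient f x"
proof -
  from assms obtain f' where f': "(f has_derivative f') (at x)"
    unfolding differentiable_def by blast
  then have lin: "linear f'" by (rule has_derivative_linear)
  have "f' = (\<lambda>h. inner h (\<Sum>b\<in>Basis. f' b *\<^sub>R b))"
  proof
    fix h :: 'a
    have "f' h = f' (\<Sum>b\<in>Basis. inner h b *\<^sub>R b)" by (simp add: euclidean_representation)
    also have "\<dots> = (\<Sum>b\<in>Basis. inner h b * f' b)"
      by (simp add: linear_sum[OF lin] linear_scale[OF lin])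
    finally show "f' h = inner h (\<Sum>b\<in>Basis. f' b *\<^sub>R b)"
      by (simp add: inner_sum_right mult.commute)
  qed
  with f' have "GDERIV f x :> (\<Sum>b\<in>Basis. f' b *\<^sub>R b)"
    unfolding gderiv_def by simp
  then show ?thesis using gradient_eqI by metis
qed


definition local_objective ::
    "('a \<Rightarrow> 'x \<Rightarrow> real) \<Rightarrow> ('n \<Rightarrow> 'x measure) \<Rightarrow> 'n \<Rightarrow> 'a \<Rightarrow> real" where
  "local_objective loss D i x = (\<integral>\<xi>. loss x \<xi> \<partial>D i)"

definition global_objective :: "('n \<Rightarrow> 'a \<Rightarrow> real) \<Rightarrow> 'n set \<Rightarrow> 'a \<Rightarrow> real" where
  "global_objective f H x = (\<Sum>i\<in>H. f i x) / real (card H)"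

definition L_smooth :: "real \<Rightarrow> ('a::real_inner \<Rightarrow> real) \<Rightarrow> bool" where
  "L_smooth L f \<longleftrightarrow>
     0 < L \<and> (\<forall>x. f differentiable (at x)) \<and> L-lipschitz_on UNIV (gradient f)"

definition bounded_dissimilarity ::
    "real \<Rightarrow> real \<Rightarrow> ('n \<Rightarrow> 'a::real_inner \<Rightarrow> real) \<Rightarrow> 'n set \<Rightarrow> bool" where
  "bounded_dissimilarity G B f H \<longleftrightarrow>
     0 \<le> G \<and> 0 \<le> B \<and>
     (\<forall>x. (\<Sum>i\<in>H. (norm (gradient (f i) x - gradient (global_objective f H) x))\<^sup>2) / real (card H)
            \<le> G\<^sup>2 + B\<^sup>2 * (norm (gradient (global_objective f H) x))\<^sup>2)"

definition robust_aggregation :: "nat \<Rightarrow> real \<Rightarrow> (real ^ 'd ^ 'n \<Rightarrow> real ^ 'd) \<Rightarrow> bool" where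
  "robust_aggregation b \<kappa> A \<longleftrightarrow>
     0 < \<kappa> \<and> 2 * b < CARD('n) \<and>
     (\<forall>(X :: real ^ 'd ^ 'n) (S :: 'n set). card S = CARD('n) - b \<longrightarrow>
        (let avg = (1 / real (CARD('n) - b)) *\<^sub>R (\<Sum>i\<in>S. X $ i)
         in (norm (A X - avg))\<^sup>2
              \<le> \<kappa> / real (CARD('n) - b) * (\<Sum>i\<in>S. (norm (X $ i - avg))\<^sup>2)))"

text \<open>
  Joint measurability of \<open>g i\<close> makes \<open>g i (x (t - 1)) (\<xi> t i)\<close> a random vector. The
  integrability conditions say that the two expectations exist; they are needed because the
  Bochner integral of a non-integrable function is 0.
\<close>

definition stochastic_oracle ::
    "real \<Rightarrow> ('n \<Rightarrow> 'x measure) \<Rightarrow> ('n \<Rightarrow> real ^ 'd \<Rightarrow> 'x \<Rightarrow> real ^ 'd) \<Rightarrow>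
     ('n \<Rightarrow> real ^ 'd \<Rightarrow> real) \<Rightarrow> 'n set \<Rightarrow> bool" where
  "stochastic_oracle \<sigma> D g f H \<longleftrightarrow>
     (\<forall>i\<in>H.
        (\<lambda>(x, \<xi>). g i x \<xi>) \<in> borel_measurable (borel \<Otimes>\<^sub>M D i) \<and>
        (\<forall>x. integrable (D i) (g i x) \<and>
             (\<integral>\<xi>. g i x \<xi> \<partial>D i) = gradient (f i) x \<and>
             integrable (D i) (\<lambda>\<xi>. (norm (g i x \<xi> - gradient (f i) x))\<^sup>2) \<and>
             (\<integral>\<xi>. (norm (g i x \<xi> - gradient (f i) x))\<^sup>2 \<partial>D i) \<le> \<sigma>\<^sup>2))"

text \<open>
  \<open>F t\<close> is the history of the whole system (honest and Byzantine) up to and including step \<open>t\<close>.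
  The samples of step \<open>t\<close> are, jointly over the honest workers, independent of \<open>F (t - 1)\<close>.
\<close>

definition fresh_samples ::
    "'w measure \<Rightarrow> (nat \<Rightarrow> 'w measure) \<Rightarrow> ('n \<Rightarrow> 'x measure) \<Rightarrow> 'n set \<Rightarrow>
     (nat \<Rightarrow> 'n \<Rightarrow> 'w \<Rightarrow> 'x) \<Rightarrow> bool" where
  "fresh_samples M F D H \<xi> \<longleftrightarrow>
     prob_space M \<and> filtration (space M) F \<and> (\<forall>t. subalgebra M (F t)) \<and>
     (\<forall>t\<ge>1.
        (\<forall>i\<in>H. \<xi> t i \<in> measurable (F t) (D i) \<and> distr M (D i) (\<xi> t i) = D i) \<and>
        prob_space.indep_set M
          (sets (F (t - 1)))
          (sets (vimage_algebra (space M) (\<lambda>\<omega>. \<lambda>i\<in>H. \<xi> t i \<omega>) (Pi\<^sub>M H D))))"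

text \<open>
  Independence of the stochastic gradients of different workers is stated at a common
  deterministic point \<open>x\<close>: at the random iterate the gradients all depend on \<open>x (t - 1)\<close> and are
  independent only conditionally on the past. Independent samples \<open>\<xi> t i\<close>, \<open>i \<in> H\<close>, satisfy it.
\<close>

definition independent_gradients ::
    "'w measure \<Rightarrow> ('n \<Rightarrow> real ^ 'd \<Rightarrow> 'x \<Rightarrow> real ^ 'd) \<Rightarrow> 'n set \<Rightarrow>
     (nat \<Rightarrow> 'n \<Rightarrow> 'w \<Rightarrow> 'x) \<Rightarrow> bool" where
  "independent_gradients M g H \<xi> \<longleftrightarrow>
     (\<forall>t\<ge>1. \<forall>x. prob_space.indep_vars M (\<lambda>_. borel) (\<lambda>i \<omega>. g i x (\<xi> t i \<omega>)) H)"

text \<open>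
  One realisation of the algorithm. The messages \<open>m t j\<close> of Byzantine workers \<open>j \<notin> H\<close> are
  unconstrained.
\<close>

definition rdsgdm ::
    "(real ^ 'd ^ 'n \<Rightarrow> real ^ 'd) \<Rightarrow> ('n \<Rightarrow> real ^ 'd \<Rightarrow> 'x \<Rightarrow> real ^ 'd) \<Rightarrow> 'n set \<Rightarrow>
     (nat \<Rightarrow> real) \<Rightarrow> (nat \<Rightarrow> real) \<Rightarrow> real ^ 'd \<Rightarrow>
     (nat \<Rightarrow> 'n \<Rightarrow> 'x) \<Rightarrow> (nat \<Rightarrow> 'n \<Rightarrow> real ^ 'd) \<Rightarrow> (nat \<Rightarrow> real ^ 'd) \<Rightarrow> bool" where
  "rdsgdm A g H \<gamma> \<beta> x0 \<xi> m x \<longleftrightarrow>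
     x 0 = x0 \<and> (\<forall>i\<in>H. m 0 i = 0) \<and>
     (\<forall>t\<ge>1.
        (\<forall>i\<in>H. m t i = \<beta> t *\<^sub>R m (t - 1) i + (1 - \<beta> t) *\<^sub>R g i (x (t - 1)) (\<xi> t i)) \<and>
        x t = x (t - 1) - \<gamma> t *\<^sub>R A (\<chi> i. m t i))"

text \<open>
  A robust aggregation rule need not be measurable, so that the expectations make sense only if
  the iterates are random vectors. We require the iterates, and nothing else, to be adapted to the
  history. The lemma below shows that this is automatic when \<open>A\<close> is Borel
  measurable and the Byzantine messages of step \<open>t\<close> are functions of the history \<open>F t\<close>.
\<close>

definition adapted_iterates :: "(nat \<Rightarrow> 'w measure) \<Rightarrow> (nat \<Rightarrow> 'w \<Rightarrow> real ^ 'd) \<Rightarrow> bool" where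
  "adapted_iterates F x \<longleftrightarrow> (\<forall>t. x t \<in> borel_measurable (F t))"

lemma adapted_iterates_if_measurable:
  fixes A :: "real ^ 'd ^ 'n \<Rightarrow> real ^ 'd" and M :: "'w measure"
  assumes fresh: "fresh_samples M F D H \<xi>"
    and first_order: "stochastic_oracle \<sigma> D g f H"
    and run: "\<forall>\<omega>\<in>space M.
      rdsgdm A g H \<gamma> \<beta> x0 (\<lambda>t i. \<xi> t i \<omega>) (\<lambda>t i. m t i \<omega>) (\<lambda>t. x t \<omega>)"
    and A: "A \<in> borel_measurable borel"
    and byz: "\<And>t j. 1 \<le> t \<Longrightarrow> j \<notin> H \<Longrightarrow> m t j \<in> borel_measurable (F t)"
  shows "adapted_iterates F x"
proof -
  have sp: "space (F t) = space M" for t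
    using fresh unfolding fresh_samples_def subalgebra_def by blast
  have mono: "u \<in> borel_measurable (F (Suc t))" if "u \<in> borel_measurable (F t)"
    for u :: "'w \<Rightarrow> real ^ 'd" and t
  proof -
    have "filtration (space M) F" using fresh by (simp add: fresh_samples_def)
    then have "sets (F t) \<subseteq> sets (F (Suc t))" unfolding filtration_def by simp
    then show ?thesis
      using that sp by (intro measurable_mono[THEN subsetD, OF order_refl refl _ _ that]) simp_all
  qed
  have "x t \<in> borel_measurable (F t) \<and> (\<forall>i\<in>H. m t i \<in> borel_measurable (F t))" for t
  proof (induction t)
    case 0
    have "x 0 \<in> borel_measurable (F 0) \<longleftrightarrow> (\<lambda>_. x0) \<in> borel_measurable (F 0)"
      using run by (intro measurable_cong) (simp add: sp rdsgdm_def)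
    moreover have "m 0 i \<in> borel_measurable (F 0) \<longleftrightarrow> (\<lambda>_. 0 :: real ^ 'd) \<in> borel_measurable (F 0)"
      if "i \<in> H" for i
      using run that by (intro measurable_cong) (simp add: sp rdsgdm_def)
    ultimately show ?case by simp
  next
    case (Suc t)
    have xt: "x t \<in> borel_measurable (F (Suc t))" using Suc by (intro mono) simp
    have honest: "m (Suc t) i \<in> borel_measurable (F (Suc t))" if "i \<in> H" for i
    proof -
      have mt: "m t i \<in> borel_measurable (F (Suc t))" using Suc that by (intro mono) simp
      have "\<xi> (Suc t) i \<in> measurable (F (Suc t)) (D i)"
        using fresh that unfolding fresh_samples_def by simp
      moreover have "(\<lambda>(x, \<xi>). g i x \<xi>) \<in> borel_measurable (borel \<Otimes>\<^sub>M D i)"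
        using first_order that unfolding stochastic_oracle_def by simp
      ultimately have "(\<lambda>\<omega>. (\<lambda>(x, \<xi>). g i x \<xi>) (x t \<omega>, \<xi> (Suc t) i \<omega>))
          \<in> borel_measurable (F (Suc t))"
        using xt by (intro measurable_compose[OF measurable_Pair]) auto
      then have "(\<lambda>\<omega>. \<beta> (Suc t) *\<^sub>R m t i \<omega>
            + (1 - \<beta> (Suc t)) *\<^sub>R g i (x t \<omega>) (\<xi> (Suc t) i \<omega>))
          \<in> borel_measurable (F (Suc t))"
        using mt by simp
      moreover have "m (Suc t) i \<omega> = \<beta> (Suc t) *\<^sub>R m t i \<omega>
            + (1 - \<beta> (Suc t)) *\<^sub>R g i (x t \<omega>) (\<xi> (Suc t) i \<omega>)" if "\<omega> \<in> space M" for \<omega>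
        using bspec[OF run that] \<open>i \<in> H\<close> unfolding rdsgdm_def by fastforce
      ultimately show ?thesis by (subst measurable_cong) (auto simp: sp)
    qed
    have all: "m (Suc t) i \<in> borel_measurable (F (Suc t))" for i
      using honest byz by (cases "i \<in> H") simp_all
    have "(\<lambda>\<omega>. \<chi> i. m (Suc t) i \<omega>) \<in> borel_measurable (F (Suc t))"
    proof (subst borel_measurable_euclidean_space, rule ballI)
      fix e :: "real ^ 'd ^ 'n" assume "e \<in> Basis"
      show "(\<lambda>\<omega>. inner (\<chi> i. m (Suc t) i \<omega>) e) \<in> borel_measurable (F (Suc t))"
        using all by (simp add: inner_vec_def[of "vec_lambda _"])
    qed
    then have "(\<lambda>\<omega>. A (\<chi> i. m (Suc t) i \<omega>)) \<in> borel_measurable (F (Suc t))"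
      by (rule measurable_compose[OF _ A])
    then have "(\<lambda>\<omega>. x t \<omega> - \<gamma> (Suc t) *\<^sub>R A (\<chi> i. m (Suc t) i \<omega>))
        \<in> borel_measurable (F (Suc t))"
      using xt by simp
    moreover have "x (Suc t) \<omega> = x t \<omega> - \<gamma> (Suc t) *\<^sub>R A (\<chi> i. m (Suc t) i \<omega>)"
      if "\<omega> \<in> space M" for \<omega>
      using bspec[OF run that] unfolding rdsgdm_def by fastforce
    ultimately have "x (Suc t) \<in> borel_measurable (F (Suc t))"
      by (subst measurable_cong) (auto simp: sp)
    with honest show ?case by simp
  qed
  then show ?thesis by (simp add: adapted_iterates_def)
qed

end

theory Submission
  imports Defs
begin

text \<open>
  Let \<open>u\<close> be the aggregate of a step. The descent inequality of an \<open>L\<close>-smooth function gives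
  \<open>fH (x - \<gamma> u) \<le> fH x - \<gamma>/2 \<parallel>\<nabla>fH x\<parallel>\<^sup>2 - \<gamma>/2 (1 - \<gamma> L) \<parallel>u\<parallel>\<^sup>2 + \<gamma>/2 \<parallel>u - \<nabla>fH x\<parallel>\<^sup>2\<close>, and the last
  term splits into two errors: the distance of \<open>u\<close> from the mean honest momentum, which robustness
  bounds by \<open>\<kappa>\<close> times the dispersion of the honest momenta, and the distance of that mean from the
  gradient. The Byzantine messages enter the proof only through the first bound.

  Both errors satisfy a linear recursion with contraction factor \<open>\<beta>\<close>, because the samples of a step
  are independent of the past: the noise is orthogonal to everything decided earlier and contributes
  \<open>(1 - \<beta>)\<^sup>2\<close> times its own second moment. For the dispersion
  (\<open>dispersion_recursion\<close>) the source is \<open>(1 - \<beta>) (G\<^sup>2 + B\<^sup>2 \<parallel>\<nabla>fH x\<parallel>\<^sup>2) + (1 - \<beta>)\<^sup>2 \<sigma>\<^sup>2\<close>. For the mean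
  (\<open>momentum_error_recursion\<close>) independence across workers reduces the noise to \<open>\<sigma>\<^sup>2 / h\<close>, and the
  motion of the iterate adds \<open>L\<^sup>2 / (1 - \<beta>)\<close> times the squared step length. Summation over time divides
  the sources by \<open>1 - \<beta> = 36 \<gamma> L\<close>, so that the noise contributes order \<open>\<gamma> L \<sigma>\<^sup>2\<close>, while the motion term
  becomes a small multiple of \<open>\<parallel>u\<parallel>\<^sup>2\<close> and is absorbed by the negative term of the descent inequality
  (\<open>gradient_sum_bound\<close>).

  Since \<open>A\<close> need not be measurable, the aggregate is handled as a multiple of the difference of two
  iterates, and all moments used are shown to be finite by induction over the steps
  (\<open>square_integrable_iterates\<close>).
\<close>

section \<open>Averages and squared norms\<close>

definition avg :: "'i set \<Rightarrow> ('i \<Rightarrow> 'a::real_vector) \<Rightarrow> 'a" where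
  "avg S v = (1 / real (card S)) *\<^sub>R (\<Sum>i\<in>S. v i)"

lemma avg_real: "avg S c = (\<Sum>i\<in>S. c i) / real (card S)" for c :: "'i \<Rightarrow> real"
  by (simp add: avg_def)

lemma avg_add: "avg S (\<lambda>i. u i + v i) = avg S u + avg S v"
  by (simp add: avg_def sum.distrib scaleR_add_right)

lemma avg_scaleR: "avg S (\<lambda>i. c *\<^sub>R v i) = c *\<^sub>R avg S v"
  by (simp add: avg_def flip: scaleR_sum_right)

lemma avg_mult: "avg S (\<lambda>i. c * v i) = c * avg S v" for c :: real
  using avg_scaleR[of S c v] by simp

lemma avg_const: "card S \<noteq> 0 \<Longrightarrow> avg S (\<lambda>_. c) = c"
  by (simp add: avg_def sum_constant_scaleR)

lemma avg_mono:
  fixes c d :: "'i \<Rightarrow> real"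
  shows "(\<And>i. i \<in> S \<Longrightarrow> c i \<le> d i) \<Longrightarrow> avg S c \<le> avg S d"
  by (simp add: avg_real divide_right_mono sum_mono)

lemma avg_norm_sq_centered_le:
  fixes v :: "'i \<Rightarrow> 'a::real_inner"
  shows "avg S (\<lambda>i. (norm (v i - avg S v))\<^sup>2) \<le> avg S (\<lambda>i. (norm (v i))\<^sup>2)"
proof (cases "card S = 0")
  case False
  let ?a = "avg S v"
  have "(\<Sum>i\<in>S. (norm (v i - ?a))\<^sup>2)
      = (\<Sum>i\<in>S. (norm (v i))\<^sup>2) - 2 * inner (\<Sum>i\<in>S. v i) ?a + real (card S) * inner ?a ?a"
    by (simp add: power2_norm_eq_inner inner_diff_left inner_diff_right inner_commute
        sum.distrib sum_subtractf inner_sum_left inner_sum_right sum_distrib_left algebra_simps)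
  also have "(\<Sum>i\<in>S. v i) = real (card S) *\<^sub>R ?a"
    using False by (simp add: avg_def)
  finally have "(\<Sum>i\<in>S. (norm (v i - ?a))\<^sup>2)
      = (\<Sum>i\<in>S. (norm (v i))\<^sup>2) - real (card S) * inner ?a ?a" by simp
  then show ?thesis by (simp add: avg_real divide_right_mono)
qed (simp add: avg_def)

lemma norm_sq_add_le: "(norm (u + v))\<^sup>2 \<le> 2 * (norm u)\<^sup>2 + 2 * (norm v)\<^sup>2"
  for u v :: "'a::real_inner"
proof -
  have "0 \<le> (norm (u - v))\<^sup>2" by simp
  then show ?thesis
    by (simp add: power2_norm_eq_inner inner_add_left inner_add_right inner_diff_left
        inner_diff_right inner_commute)
qed

lemma norm_sq_convex:
  fixes u v :: "'a::real_inner"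
  assumes "0 \<le> c" "c \<le> 1"
  shows "(norm (c *\<^sub>R u + (1 - c) *\<^sub>R v))\<^sup>2 \<le> c * (norm u)\<^sup>2 + (1 - c) * (norm v)\<^sup>2"
proof -
  have "c * (norm u)\<^sup>2 + (1 - c) * (norm v)\<^sup>2 - (norm (c *\<^sub>R u + (1 - c) *\<^sub>R v))\<^sup>2
      = c * (1 - c) * (norm (u - v))\<^sup>2"
    by (simp add: power2_norm_eq_inner inner_add_left inner_add_right inner_diff_left
        inner_diff_right inner_commute) (simp add: algebra_simps)
  moreover have "0 \<le> c * (1 - c) * (norm (u - v))\<^sup>2" using assms by simp
  ultimately show ?thesis by linarith
qed

text \<open>
  Young's inequality with the weight for which the squared contraction factor \<open>c\<^sup>2\<close> becomes \<open>c\<close>: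
  it is convexity applied to \<open>c u + (1 - c) (c / (1 - c)) v\<close>.
\<close>

lemma norm_sq_young:
  fixes u v :: "'a::real_inner"
  assumes "0 \<le> c" "c < 1"
  shows "(norm (c *\<^sub>R (u + v)))\<^sup>2 \<le> c * (norm u)\<^sup>2 + (norm v)\<^sup>2 / (1 - c)"
proof -
  have "(norm (c *\<^sub>R (u + v)))\<^sup>2 \<le> c * (norm u)\<^sup>2 + (1 - c) * (norm ((c / (1 - c)) *\<^sub>R v))\<^sup>2"
    using norm_sq_convex[of c u "(c / (1 - c)) *\<^sub>R v"] assms by (simp add: scaleR_add_right)
  also have "(1 - c) * (norm ((c / (1 - c)) *\<^sub>R v))\<^sup>2 = c\<^sup>2 * ((norm v)\<^sup>2 / (1 - c))"
    using assms by (simp add: power_mult_distrib power_divide power2_eq_square)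
  also have "\<dots> \<le> 1 * ((norm v)\<^sup>2 / (1 - c))"
    using assms by (intro mult_right_mono) (auto simp: power_le_one)
  finally show ?thesis by simp
qed

section \<open>Smooth functions and their gradients\<close>

lemma gradient_global_objective:
  fixes f :: "'n \<Rightarrow> 'a::euclidean_space \<Rightarrow> real"
  assumes "\<And>i. i \<in> H \<Longrightarrow> f i differentiable (at y)"
  shows "gradient (global_objective f H) y = avg H (\<lambda>i. gradient (f i) y)"
proof (rule gradient_eqI)
  have "((\<lambda>y. (\<Sum>i\<in>H. f i y) / real (card H)) has_derivative
      (\<lambda>v. (\<Sum>i\<in>H. inner v (gradient (f i) y)) / real (card H))) (at y)"
    using GDERIV_gradient[OF assms] unfolding gderiv_def
    by (auto intro!: derivative_eq_intros simp: divide_inverse)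
  moreover have "(\<lambda>y. (\<Sum>i\<in>H. f i y) / real (card H)) = global_objective f H"
    by (simp add: fun_eq_iff global_objective_def)
  ultimately show "GDERIV (global_objective f H) y :> avg H (\<lambda>i. gradient (f i) y)"
    by (simp add: gderiv_def avg_def inner_sum_right)
qed

text \<open>
  The difference of the two sides, restricted to the segment from \<open>y\<close> to \<open>z\<close>, has a nonpositive
  derivative by the Lipschitz bound and the Cauchy-Schwarz inequality.
\<close>

lemma L_smooth_quadratic_upper_bound:
  fixes f :: "'a::euclidean_space \<Rightarrow> real"
  assumes "L_smooth L f"
  shows "f z \<le> f y + inner (gradient f y) (z - y) + L / 2 * (norm (z - y))\<^sup>2"
proof -
  define d where "d = z - y"
  define \<phi> where "\<phi> s = f (y + s *\<^sub>R d) - (s * inner (gradient f y) d + L / 2 * s\<^sup>2 * (norm d)\<^sup>2)" for s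
  have lip: "norm (gradient f u - gradient f v) \<le> L * norm (u - v)" for u v
    using assms by (auto simp: L_smooth_def lipschitz_on_def dist_norm)
  have "\<exists>e. (\<phi> has_real_derivative e) (at s) \<and> e \<le> 0" if "0 \<le> s" "s \<le> 1" for s
  proof (intro exI conjI)
    have "(f has_derivative (\<lambda>v. inner v (gradient f (y + s *\<^sub>R d)))) (at (y + s *\<^sub>R d))"
      using assms GDERIV_gradient unfolding L_smooth_def gderiv_def by blast
    moreover have "((\<lambda>s. y + s *\<^sub>R d) has_derivative (\<lambda>r. r *\<^sub>R d)) (at s)"
      by (auto intro!: derivative_eq_intros)
    ultimately have "((\<lambda>s. f (y + s *\<^sub>R d)) has_derivative
        (\<lambda>r. inner (r *\<^sub>R d) (gradient f (y + s *\<^sub>R d)))) (at s)"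
      by (rule has_derivative_compose[rotated])
    then have "((\<lambda>s. f (y + s *\<^sub>R d)) has_real_derivative inner d (gradient f (y + s *\<^sub>R d))) (at s)"
      by (simp add: has_field_derivative_def mult_commute_abs)
    moreover have "((\<lambda>s. s * inner (gradient f y) d + L / 2 * s\<^sup>2 * (norm d)\<^sup>2)
        has_real_derivative inner (gradient f y) d + L * s * (norm d)\<^sup>2) (at s)"
      by (auto intro!: derivative_eq_intros)
    ultimately show "(\<phi> has_real_derivative inner d (gradient f (y + s *\<^sub>R d))
        - (inner (gradient f y) d + L * s * (norm d)\<^sup>2)) (at s)"
      unfolding \<phi>_def by (rule DERIV_diff)
    have "inner (gradient f (y + s *\<^sub>R d) - gradient f y) d
        \<le> norm (gradient f (y + s *\<^sub>R d) - gradient f y) * norm d"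
      by (rule norm_cauchy_schwarz)
    also have "\<dots> \<le> (L * norm (s *\<^sub>R d)) * norm d"
      using lip[of "y + s *\<^sub>R d" y] by (intro mult_right_mono) auto
    also have "\<dots> = L * s * (norm d)\<^sup>2"
      using that by (simp add: power2_eq_square)
    finally show "inner d (gradient f (y + s *\<^sub>R d)) - (inner (gradient f y) d + L * s * (norm d)\<^sup>2) \<le> 0"
      by (simp add: inner_diff_left inner_commute[of d "gradient f (y + s *\<^sub>R d)"])
  qed
  then have "\<phi> 1 \<le> \<phi> 0"
    using DERIV_nonpos_imp_nonincreasing[of 0 1 \<phi>] by simp
  then show ?thesis by (simp add: \<phi>_def d_def)
qed

text \<open>One gradient step of length \<open>1 / L\<close> lowers \<open>f\<close> by at least \<open>\<parallel>\<nabla>f y\<parallel>\<^sup>2 / (2 L)\<close>.\<close>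

lemma L_smooth_gradient_bound:
  fixes f :: "'a::euclidean_space \<Rightarrow> real"
  assumes "L_smooth L f" "bdd_below (range f)"
  shows "(norm (gradient f y))\<^sup>2 \<le> 2 * L * (f y - (INF z. f z))"
proof -
  have L: "0 < L" using assms(1) by (simp add: L_smooth_def)
  define z where "z = y - (1 / L) *\<^sub>R gradient f y"
  have "(INF z. f z) \<le> f z" by (rule cINF_lower[OF assms(2)]) simp
  also have "f z \<le> f y + inner (gradient f y) (z - y) + L / 2 * (norm (z - y))\<^sup>2"
    by (rule L_smooth_quadratic_upper_bound[OF assms(1)])
  also have "\<dots> = f y - (norm (gradient f y))\<^sup>2 / (2 * L)"
    using L by (simp add: z_def power_divide dot_square_norm) (simp add: field_simps power2_eq_square)
  finally show ?thesis using L by (simp add: field_simps)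
qed

text \<open>
  The identity \<open>- 2 \<langle>\<nabla>f y, u\<rangle> = \<parallel>u - \<nabla>f y\<parallel>\<^sup>2 - \<parallel>\<nabla>f y\<parallel>\<^sup>2 - \<parallel>u\<parallel>\<^sup>2\<close> keeps the negative multiple of
  \<open>\<parallel>u\<parallel>\<^sup>2\<close>, which later absorbs the drift of the gradient between two steps.
\<close>

lemma L_smooth_descent:
  fixes f :: "'a::euclidean_space \<Rightarrow> real"
  assumes "L_smooth L f"
  shows "f (y - \<gamma> *\<^sub>R u) \<le> f y - \<gamma> / 2 * (norm (gradient f y))\<^sup>2
    - \<gamma> / 2 * (1 - \<gamma> * L) * (norm u)\<^sup>2 + \<gamma> / 2 * (norm (u - gradient f y))\<^sup>2"
proof -
  have inner_eq: "inner (gradient f y) u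
      = ((norm (gradient f y))\<^sup>2 + (norm u)\<^sup>2 - (norm (u - gradient f y))\<^sup>2) / 2"
    by (simp add: power2_norm_eq_inner inner_diff_left inner_diff_right inner_commute)
  have "f (y - \<gamma> *\<^sub>R u) \<le> f y - \<gamma> * inner (gradient f y) u + L / 2 * (\<gamma>\<^sup>2 * (norm u)\<^sup>2)"
    using L_smooth_quadratic_upper_bound[OF assms, of "y - \<gamma> *\<^sub>R u" y]
    by (simp add: power_mult_distrib)
  also have "\<dots> = f y - \<gamma> / 2 * (norm (gradient f y))\<^sup>2 - \<gamma> / 2 * (1 - \<gamma> * L) * (norm u)\<^sup>2
      + \<gamma> / 2 * (norm (u - gradient f y))\<^sup>2"
    unfolding inner_eq by (simp add: diff_divide_distrib add_divide_distrib left_diff_distrib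
      right_diff_distrib distrib_left power2_eq_square)
  finally show ?thesis .
qed

section \<open>Square-integrable random vectors\<close>

definition square_integrable :: "'w measure \<Rightarrow> ('w \<Rightarrow> 'a::euclidean_space) \<Rightarrow> bool" where
  "square_integrable M X \<longleftrightarrow> X \<in> borel_measurable M \<and> integrable M (\<lambda>\<omega>. (norm (X \<omega>))\<^sup>2)"

lemma square_integrable_measurable:
  "square_integrable M X \<Longrightarrow> X \<in> borel_measurable M"
  by (simp add: square_integrable_def)

lemma square_integrable_integrable:
  "square_integrable M X \<Longrightarrow> integrable M (\<lambda>\<omega>. (norm (X \<omega>))\<^sup>2)"
  by (simp add: square_integrable_def)

lemma square_integrable_cong:
  "(\<And>\<omega>. \<omega> \<in> space M \<Longrightarrow> X \<omega> = Y \<omega>) \<Longrightarrow> square_integrable M X \<longleftrightarrow> square_integrable M Y"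
  unfolding square_integrable_def
  by (intro conj_cong measurable_cong Bochner_Integration.integrable_cong) auto

lemma square_integrable_bound:
  assumes "X \<in> borel_measurable M" "integrable M u"
    and "\<And>\<omega>. \<omega> \<in> space M \<Longrightarrow> (norm (X \<omega>))\<^sup>2 \<le> u \<omega>"
  shows "square_integrable M X"
  unfolding square_integrable_def
proof (intro conjI)
  show "integrable M (\<lambda>\<omega>. (norm (X \<omega>))\<^sup>2)"
    using assms(1) by (intro Bochner_Integration.integrable_bound[OF assms(2)])
      (auto intro!: AE_I2 order_trans[OF assms(3)])
qed fact

lemma square_integrable_add:
  assumes "square_integrable M X" "square_integrable M Y"
  shows "square_integrable M (\<lambda>\<omega>. X \<omega> + Y \<omega>)"
proof (rule square_integrable_bound)
  show "integrable M (\<lambda>\<omega>. 2 * (norm (X \<omega>))\<^sup>2 + 2 * (norm (Y \<omega>))\<^sup>2)"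
    using assms by (auto simp: square_integrable_def)
qed (use assms in \<open>auto simp: square_integrable_def norm_sq_add_le\<close>)

lemma square_integrable_scaleR:
  "square_integrable M X \<Longrightarrow> square_integrable M (\<lambda>\<omega>. c *\<^sub>R X \<omega>)"
  unfolding square_integrable_def power_mult_distrib norm_scaleR
  by (intro conjI borel_measurable_scaleR borel_measurable_const integrable_mult_right) auto

lemma square_integrable_diff:
  assumes "square_integrable M X" "square_integrable M Y"
  shows "square_integrable M (\<lambda>\<omega>. X \<omega> - Y \<omega>)"
  using square_integrable_add[OF assms(1) square_integrable_scaleR[OF assms(2), of "-1"]] by simp

lemma square_integrable_zero: "square_integrable M (\<lambda>_. 0)"
  by (simp add: square_integrable_def)

lemma square_integrable_sum:
  "(\<And>i. i \<in> S \<Longrightarrow> square_integrable M (X i)) \<Longrightarrow> square_integrable M (\<lambda>\<omega>. \<Sum>i\<in>S. X i \<omega>)"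
  by (induction S rule: infinite_finite_induct)
    (auto intro: square_integrable_add square_integrable_zero)

lemma square_integrable_avg:
  "(\<And>i. i \<in> S \<Longrightarrow> square_integrable M (X i)) \<Longrightarrow> square_integrable M (\<lambda>\<omega>. avg S (\<lambda>i. X i \<omega>))"
  unfolding avg_def by (intro square_integrable_scaleR square_integrable_sum)

lemma (in finite_measure) square_integrable_const: "square_integrable M (\<lambda>_. c)"
  by (simp add: square_integrable_def)

lemma integrable_inner_square_integrable:
  fixes X Y :: "'w \<Rightarrow> 'a::euclidean_space"
  assumes "square_integrable M X" "square_integrable M Y"
  shows "integrable M (\<lambda>\<omega>. inner (X \<omega>) (Y \<omega>))"
proof (rule Bochner_Integration.integrable_bound)
  show "integrable M (\<lambda>\<omega>. (norm (X \<omega>))\<^sup>2 + (norm (Y \<omega>))\<^sup>2)"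
    using assms by (auto simp: square_integrable_def)
  have "\<bar>inner u v\<bar> \<le> (norm u)\<^sup>2 + (norm v)\<^sup>2" for u v :: 'a
  proof -
    have "\<bar>inner u v\<bar> \<le> norm u * norm v" by (rule Cauchy_Schwarz_ineq2)
    also have "\<dots> \<le> 2 * norm u * norm v" by simp
    also have "\<dots> \<le> (norm u)\<^sup>2 + (norm v)\<^sup>2" by (rule sum_squares_bound)
    finally show ?thesis .
  qed
  then show "AE \<omega> in M. norm (inner (X \<omega>) (Y \<omega>)) \<le> norm ((norm (X \<omega>))\<^sup>2 + (norm (Y \<omega>))\<^sup>2)"
    by simp
qed (use assms in \<open>auto simp: square_integrable_def\<close>)

lemma integral_norm_sq_add_orthogonal:
  assumes "square_integrable M X" "square_integrable M Y" "(\<integral>\<omega>. inner (X \<omega>) (Y \<omega>) \<partial>M) = 0"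
  shows "(\<integral>\<omega>. (norm (X \<omega> + c *\<^sub>R Y \<omega>))\<^sup>2 \<partial>M)
    = (\<integral>\<omega>. (norm (X \<omega>))\<^sup>2 \<partial>M) + c\<^sup>2 * (\<integral>\<omega>. (norm (Y \<omega>))\<^sup>2 \<partial>M)"
proof -
  have "(norm (X \<omega> + c *\<^sub>R Y \<omega>))\<^sup>2
      = (norm (X \<omega>))\<^sup>2 + 2 * c * inner (X \<omega>) (Y \<omega>) + c\<^sup>2 * (norm (Y \<omega>))\<^sup>2" for \<omega>
    by (simp add: power2_norm_eq_inner inner_add_left inner_add_right inner_commute)
      (simp add: algebra_simps power2_eq_square)
  then show ?thesis
    using assms integrable_inner_square_integrable[OF assms(1,2)]
    by (simp add: square_integrable_def)
qed

section \<open>Functions of two independent random variables\<close>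

context prob_space
begin

text \<open>
  The form of \<^const>\<open>indep_var\<close> in which \<open>X\<close> and \<open>Z\<close> may take values in different types: here
  \<open>X\<close> is built from points of the parameter space and \<open>Z\<close> is a family of data samples.
\<close>

definition indep_pair :: "'s measure \<Rightarrow> ('a \<Rightarrow> 's) \<Rightarrow> 'z measure \<Rightarrow> ('a \<Rightarrow> 'z) \<Rightarrow> bool" where
  "indep_pair S X Q Z \<longleftrightarrow> X \<in> measurable M S \<and> Z \<in> measurable M Q \<and>
     distr M S X \<Otimes>\<^sub>M distr M Q Z = distr M (S \<Otimes>\<^sub>M Q) (\<lambda>\<omega>. (X \<omega>, Z \<omega>))"

lemma indep_pair_if_indep_var: "indep_var S X Q Z \<Longrightarrow> indep_pair S X Q Z"
  by (simp add: indep_pair_def indep_var_distribution_eq)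

lemma indep_pairI:
  assumes F: "subalgebra M F" and indep: "indep_set (sets F) (sets (vimage_algebra (space M) Z Q))"
    and X: "X \<in> measurable F S" and Z[measurable]: "Z \<in> measurable M Q"
  shows "indep_pair S X Q Z"
proof -
  have XM[measurable]: "X \<in> measurable M S" by (rule measurable_from_subalg[OF F X])
  have space: "space F = space M" using F by (simp add: subalgebra_def)
  interpret X: prob_space "distr M S X" by (rule prob_space_distr) fact
  interpret Z: prob_space "distr M Q Z" by (rule prob_space_distr) fact
  have "distr M S X \<Otimes>\<^sub>M distr M Q Z = distr M (S \<Otimes>\<^sub>M Q) (\<lambda>\<omega>. (X \<omega>, Z \<omega>))"
  proof (rule pair_measure_eqI)
    fix A B assume "A \<in> sets (distr M S X)" "B \<in> sets (distr M Q Z)"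
    then have [measurable]: "A \<in> sets S" "B \<in> sets Q" by auto
    let ?A = "X -` A \<inter> space M" and ?B = "Z -` B \<inter> space M"
    have "?A \<in> sets F" using measurable_sets[OF X, of A] by (simp add: space)
    moreover have "?B \<in> sets (vimage_algebra (space M) Z Q)"
      by (rule in_vimage_algebra) simp
    ultimately have "prob (?A \<inter> ?B) = prob ?A * prob ?B"
      using indep by (simp add: indep_sets2_eq)
    moreover have "?A \<inter> ?B = (\<lambda>\<omega>. (X \<omega>, Z \<omega>)) -` (A \<times> B) \<inter> space M" by auto
    ultimately show "emeasure (distr M S X) A * emeasure (distr M Q Z) B
        = emeasure (distr M (S \<Otimes>\<^sub>M Q) (\<lambda>\<omega>. (X \<omega>, Z \<omega>))) (A \<times> B)"
      by (simp add: emeasure_distr emeasure_eq_measure ennreal_mult)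
  qed (auto intro: X.sigma_finite_measure_axioms Z.sigma_finite_measure_axioms)
  then show ?thesis by (simp add: indep_pair_def XM)
qed

lemma nn_integral_indep_pair:
  assumes indep: "indep_pair S X Q Z" and \<phi>: "\<phi> \<in> borel_measurable (S \<Otimes>\<^sub>M Q)"
  shows "(\<integral>\<^sup>+\<omega>. \<phi> (X \<omega>, Z \<omega>) \<partial>M) = (\<integral>\<^sup>+\<omega>. (\<integral>\<^sup>+\<omega>'. \<phi> (X \<omega>, Z \<omega>') \<partial>M) \<partial>M)"
proof -
  have X[measurable]: "X \<in> measurable M S" and Z[measurable]: "Z \<in> measurable M Q"
    and eq: "distr M S X \<Otimes>\<^sub>M distr M Q Z = distr M (S \<Otimes>\<^sub>M Q) (\<lambda>\<omega>. (X \<omega>, Z \<omega>))"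
    using indep by (auto simp: indep_pair_def)
  interpret Z: prob_space "distr M Q Z" by (rule prob_space_distr) fact
  note [measurable] = \<phi>
  have "(\<integral>\<^sup>+\<omega>. \<phi> (X \<omega>, Z \<omega>) \<partial>M) = (\<integral>\<^sup>+p. \<phi> p \<partial>(distr M S X \<Otimes>\<^sub>M distr M Q Z))"
    unfolding eq by (simp add: nn_integral_distr)
  also have "\<dots> = (\<integral>\<^sup>+s. (\<integral>\<^sup>+z. \<phi> (s, z) \<partial>distr M Q Z) \<partial>distr M S X)"
    by (rule Z.nn_integral_fst[symmetric]) simp
  also have "\<dots> = (\<integral>\<^sup>+\<omega>. (\<integral>\<^sup>+z. \<phi> (X \<omega>, z) \<partial>distr M Q Z) \<partial>M)"
    by (rule nn_integral_distr) (auto intro!: Z.borel_measurable_nn_integral)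
  also have "\<dots> = (\<integral>\<^sup>+\<omega>. (\<integral>\<^sup>+\<omega>'. \<phi> (X \<omega>, Z \<omega>') \<partial>M) \<partial>M)"
    by (intro nn_integral_cong nn_integral_distr) (auto dest: measurable_space[OF X])
  finally show ?thesis .
qed

lemma integral_indep_pair:
  fixes \<phi> :: "'s \<times> 'z \<Rightarrow> real"
  assumes indep: "indep_pair S X Q Z" and \<phi>: "\<phi> \<in> borel_measurable (S \<Otimes>\<^sub>M Q)"
    and int: "integrable M (\<lambda>\<omega>. \<phi> (X \<omega>, Z \<omega>))"
  shows "(\<integral>\<omega>. \<phi> (X \<omega>, Z \<omega>) \<partial>M) = (\<integral>\<omega>. (\<integral>\<omega>'. \<phi> (X \<omega>, Z \<omega>') \<partial>M) \<partial>M)"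
proof -
  have X[measurable]: "X \<in> measurable M S" and Z[measurable]: "Z \<in> measurable M Q"
    and eq: "distr M S X \<Otimes>\<^sub>M distr M Q Z = distr M (S \<Otimes>\<^sub>M Q) (\<lambda>\<omega>. (X \<omega>, Z \<omega>))"
    using indep by (auto simp: indep_pair_def)
  interpret X: prob_space "distr M S X" by (rule prob_space_distr) fact
  interpret Z: prob_space "distr M Q Z" by (rule prob_space_distr) fact
  interpret XZ: pair_prob_space "distr M S X" "distr M Q Z" ..
  note [measurable] = \<phi>
  have "integrable (distr M S X \<Otimes>\<^sub>M distr M Q Z) \<phi>"
    unfolding eq using int by (simp add: integrable_distr_eq)
  then have fst: "(\<integral>p. \<phi> p \<partial>(distr M S X \<Otimes>\<^sub>M distr M Q Z))
      = (\<integral>s. (\<integral>z. \<phi> (s, z) \<partial>distr M Q Z) \<partial>distr M S X)"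
    using XZ.integral_fst'[of \<phi>] by simp
  have "(\<integral>\<omega>. \<phi> (X \<omega>, Z \<omega>) \<partial>M) = (\<integral>p. \<phi> p \<partial>(distr M S X \<Otimes>\<^sub>M distr M Q Z))"
    unfolding eq by (simp add: integral_distr)
  also have "\<dots> = (\<integral>\<omega>. (\<integral>z. \<phi> (X \<omega>, z) \<partial>distr M Q Z) \<partial>M)"
    unfolding fst by (rule integral_distr) (auto intro!: Z.borel_measurable_lebesgue_integral)
  also have "\<dots> = (\<integral>\<omega>. (\<integral>\<omega>'. \<phi> (X \<omega>, Z \<omega>') \<partial>M) \<partial>M)"
    by (intro Bochner_Integration.integral_cong refl integral_distr)
      (auto dest: measurable_space[OF X])
  finally show ?thesis .
qed

text \<open>
  This plays the role of a conditional expectation: noise whose mean vanishes for every frozen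
  value of \<open>X\<close> is orthogonal to all square-integrable functions of \<open>X\<close>.
\<close>

lemma integral_inner_indep_pair_centered:
  fixes V :: "'s \<Rightarrow> 'v::euclidean_space"
  assumes indep: "indep_pair S X Q Z" and V: "V \<in> borel_measurable S"
    and N: "N \<in> borel_measurable (S \<Otimes>\<^sub>M Q)"
    and si: "square_integrable M (\<lambda>\<omega>. V (X \<omega>))" "square_integrable M (\<lambda>\<omega>. N (X \<omega>, Z \<omega>))"
    and int: "\<And>s. s \<in> space S \<Longrightarrow> integrable M (\<lambda>\<omega>. N (s, Z \<omega>))"
    and centered: "\<And>s. s \<in> space S \<Longrightarrow> (\<integral>\<omega>. N (s, Z \<omega>) \<partial>M) = 0"
  shows "(\<integral>\<omega>. inner (V (X \<omega>)) (N (X \<omega>, Z \<omega>)) \<partial>M) = 0"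
proof -
  note [measurable] = V N
  have X: "X \<in> measurable M S" using indep by (simp add: indep_pair_def)
  have "(\<integral>\<omega>. inner (V (X \<omega>)) (N (X \<omega>, Z \<omega>)) \<partial>M)
      = (\<integral>\<omega>. (\<integral>\<omega>'. inner (V (X \<omega>)) (N (X \<omega>, Z \<omega>')) \<partial>M) \<partial>M)"
    using integral_indep_pair[OF indep, of "\<lambda>p. inner (V (fst p)) (N p)"]
      integrable_inner_square_integrable[OF si] by simp
  also have "\<dots> = (\<integral>\<omega>. 0 \<partial>M)"
    using int centered measurable_space[OF X]
    by (intro Bochner_Integration.integral_cong) simp_all
  finally show ?thesis by simp
qed

lemma second_moment_indep_pair_le:
  fixes N :: "'s \<times> 'z \<Rightarrow> 'v::euclidean_space"
  assumes indep: "indep_pair S X Q Z" and N: "N \<in> borel_measurable (S \<Otimes>\<^sub>M Q)"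
    and si: "\<And>s. s \<in> space S \<Longrightarrow> square_integrable M (\<lambda>\<omega>. N (s, Z \<omega>))"
    and le: "\<And>s. s \<in> space S \<Longrightarrow> (\<integral>\<omega>. (norm (N (s, Z \<omega>)))\<^sup>2 \<partial>M) \<le> v"
  shows "square_integrable M (\<lambda>\<omega>. N (X \<omega>, Z \<omega>))"
    and "(\<integral>\<omega>. (norm (N (X \<omega>, Z \<omega>)))\<^sup>2 \<partial>M) \<le> v"
proof -
  note [measurable] = N
  have X[measurable]: "X \<in> measurable M S" and Z[measurable]: "Z \<in> measurable M Q"
    using indep by (simp_all add: indep_pair_def)
  have inner_le: "(\<integral>\<^sup>+\<omega>'. ennreal ((norm (N (X \<omega>, Z \<omega>')))\<^sup>2) \<partial>M) \<le> ennreal v" if "\<omega> \<in> space M" for \<omega>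
  proof -
    have "X \<omega> \<in> space S" using measurable_space[OF X that] .
    then show ?thesis
      using si[of "X \<omega>"] le[of "X \<omega>"]
      by (subst nn_integral_eq_integral) (simp_all add: square_integrable_def ennreal_leI)
  qed
  have "(\<integral>\<^sup>+\<omega>. ennreal ((norm (N (X \<omega>, Z \<omega>)))\<^sup>2) \<partial>M)
      = (\<integral>\<^sup>+\<omega>. (\<integral>\<^sup>+\<omega>'. ennreal ((norm (N (X \<omega>, Z \<omega>')))\<^sup>2) \<partial>M) \<partial>M)"
    using nn_integral_indep_pair[OF indep, of "\<lambda>p. ennreal ((norm (N p))\<^sup>2)"] by simp
  also have "\<dots> \<le> (\<integral>\<^sup>+\<omega>. ennreal v \<partial>M)" by (rule nn_integral_mono) (rule inner_le)
  also have "\<dots> = ennreal v" by (simp add: emeasure_space_1)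
  finally have bound: "(\<integral>\<^sup>+\<omega>. ennreal ((norm (N (X \<omega>, Z \<omega>)))\<^sup>2) \<partial>M) \<le> ennreal v" .
  then show "square_integrable M (\<lambda>\<omega>. N (X \<omega>, Z \<omega>))"
    unfolding square_integrable_def
    using le_less_trans[OF bound ennreal_less_top] by (intro conjI integrableI_nonneg) simp_all
  obtain \<omega> where "\<omega> \<in> space M" using not_empty by auto
  then have "0 \<le> v"
    by (intro order_trans[OF Bochner_Integration.integral_nonneg le[OF measurable_space[OF X]]]) simp_all
  then show "(\<integral>\<omega>. (norm (N (X \<omega>, Z \<omega>)))\<^sup>2 \<partial>M) \<le> v"
    using bound by (rule integral_real_bounded)
qed

text \<open>Independent centered vectors are pairwise orthogonal, so that only the diagonal survives.\<close>

lemma integral_norm_sq_sum_indep_le: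
  fixes W :: "'i \<Rightarrow> 'a \<Rightarrow> 'v::euclidean_space"
  assumes indep: "indep_vars (\<lambda>_. borel) W S"
    and si: "\<And>i. i \<in> S \<Longrightarrow> square_integrable M (W i)"
    and int: "\<And>i. i \<in> S \<Longrightarrow> integrable M (W i)"
    and centered: "\<And>i. i \<in> S \<Longrightarrow> (\<integral>\<omega>. W i \<omega> \<partial>M) = 0"
    and var: "\<And>i. i \<in> S \<Longrightarrow> (\<integral>\<omega>. (norm (W i \<omega>))\<^sup>2 \<partial>M) \<le> s"
  shows "(\<integral>\<omega>. (norm (\<Sum>i\<in>S. W i \<omega>))\<^sup>2 \<partial>M) \<le> real (card S) * s"
proof (cases "finite S")
  case True
  have orth: "(\<integral>\<omega>. inner (W i \<omega>) (W j \<omega>) \<partial>M) = 0" if "i \<in> S" "j \<in> S" "i \<noteq> j" for i j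
  proof -
    have "indep_pair borel (W i) borel (W j)"
    proof (rule indep_pair_if_indep_var)
      have "indep_var (Pi\<^sub>M {i} (\<lambda>_. borel)) (\<lambda>\<omega>. \<lambda>k\<in>{i}. W k \<omega>)
          (Pi\<^sub>M {j} (\<lambda>_. borel)) (\<lambda>\<omega>. \<lambda>k\<in>{j}. W k \<omega>)"
        using that by (intro indep_var_restrict[OF indep]) auto
      from indep_var_compose[OF this, of "\<lambda>p. p i" borel "\<lambda>p. p j" borel]
      show "indep_var borel (W i) borel (W j)" by (simp add: comp_def)
    qed
    from integral_inner_indep_pair_centered[OF this, of "\<lambda>s. s" snd]
    show ?thesis using si int centered that by simp
  qed
  have I: "integrable M (\<lambda>\<omega>. inner (W j \<omega>) (W i \<omega>))" if "i \<in> S" "j \<in> S" for i j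
    using si that by (intro integrable_inner_square_integrable)
  have "(\<integral>\<omega>. (norm (\<Sum>i\<in>S. W i \<omega>))\<^sup>2 \<partial>M) = (\<integral>\<omega>. (\<Sum>i\<in>S. \<Sum>j\<in>S. inner (W j \<omega>) (W i \<omega>)) \<partial>M)"
    by (simp add: power2_norm_eq_inner inner_sum_left inner_sum_right)
  also have "\<dots> = (\<Sum>i\<in>S. \<Sum>j\<in>S. \<integral>\<omega>. inner (W j \<omega>) (W i \<omega>) \<partial>M)"
    using I by (simp add: Bochner_Integration.integral_sum)
  also have "\<dots> = (\<Sum>i\<in>S. \<Sum>j\<in>S. if j = i then (\<integral>\<omega>. (norm (W i \<omega>))\<^sup>2 \<partial>M) else 0)"
    using orth by (intro sum.cong refl) (auto simp: power2_norm_eq_inner)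
  also have "\<dots> = (\<Sum>i\<in>S. \<integral>\<omega>. (norm (W i \<omega>))\<^sup>2 \<partial>M)"
    using True by (simp add: sum.delta)
  also have "\<dots> \<le> real (card S) * s"
    using sum_mono[of S _ "\<lambda>_. s", OF var] by simp
  finally show ?thesis .
qed simp

end

section \<open>One run of the algorithm\<close>

locale byzantine_momentum = prob_space M
  for M :: "'w measure" +
  fixes H :: "'n::finite set"
    and A :: "real ^ 'd ^ 'n \<Rightarrow> real ^ 'd"
    and D :: "'n \<Rightarrow> 'x measure"
    and g :: "'n \<Rightarrow> real ^ 'd \<Rightarrow> 'x \<Rightarrow> real ^ 'd"
    and f :: "'n \<Rightarrow> real ^ 'd \<Rightarrow> real"
    and F :: "nat \<Rightarrow> 'w measure"
    and \<xi> :: "nat \<Rightarrow> 'n \<Rightarrow> 'w \<Rightarrow> 'x"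
    and m :: "nat \<Rightarrow> 'n \<Rightarrow> 'w \<Rightarrow> real ^ 'd"
    and x :: "nat \<Rightarrow> 'w \<Rightarrow> real ^ 'd"
    and x0 :: "real ^ 'd"
    and b :: nat
    and L G B \<sigma> \<kappa> \<gamma> \<beta> :: real
  assumes card_H: "card H = CARD('n) - b"
    and f_differentiable: "\<And>i y. i \<in> H \<Longrightarrow> f i differentiable (at y)"
    and smooth: "L_smooth L (global_objective f H)"
    and dissimilarity: "bounded_dissimilarity G B f H"
    and first_order: "stochastic_oracle \<sigma> D g f H"
    and robust: "robust_aggregation b \<kappa> A"
    and samples: "fresh_samples M F D H \<xi>"
    and independence: "independent_gradients M g H \<xi>"
    and \<gamma>_pos: "0 < \<gamma>"
    and \<beta>_nonneg: "0 \<le> \<beta>" and \<beta>_less_1: "\<beta> < 1"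
    and run: "\<And>\<omega>. \<omega> \<in> space M \<Longrightarrow>
      rdsgdm A g H (\<lambda>_. \<gamma>) (\<lambda>_. \<beta>) x0 (\<lambda>t i. \<xi> t i \<omega>) (\<lambda>t i. m t i \<omega>) (\<lambda>t. x t \<omega>)"
    and adapted: "adapted_iterates F x"
begin

abbreviation fH :: "real ^ 'd \<Rightarrow> real" where "fH \<equiv> global_objective f H"

abbreviation grad :: "real ^ 'd \<Rightarrow> real ^ 'd" where "grad \<equiv> gradient fH"

definition noise :: "nat \<Rightarrow> 'n \<Rightarrow> 'w \<Rightarrow> real ^ 'd" where
  "noise t i \<omega> = g i (x t \<omega>) (\<xi> (Suc t) i \<omega>) - gradient (f i) (x t \<omega>)"

definition mean_momentum :: "nat \<Rightarrow> 'w \<Rightarrow> real ^ 'd" where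
  "mean_momentum t \<omega> = avg H (\<lambda>i. m t i \<omega>)"

definition dispersion :: "nat \<Rightarrow> 'w \<Rightarrow> real" where
  "dispersion t \<omega> = avg H (\<lambda>i. (norm (m t i \<omega> - mean_momentum t \<omega>))\<^sup>2)"

text \<open>
  The momentum of step \<open>t\<close> estimates the gradient at the previous iterate. Truncated subtraction
  makes the value at \<open>t = 0\<close> equal to \<open>- grad x0\<close>, which is the right initial error, since the
  momentum starts at zero.
\<close>

definition momentum_error :: "nat \<Rightarrow> 'w \<Rightarrow> real ^ 'd" where
  "momentum_error t \<omega> = mean_momentum t \<omega> - grad (x (t - 1) \<omega>)"

lemma L_pos: "0 < L"
  using smooth by (simp add: L_smooth_def)

lemma \<kappa>_pos: "0 < \<kappa>"
  using robust by (simp add: robust_aggregation_def)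

lemma card_H_pos: "0 < card H"
  using robust card_H by (simp add: robust_aggregation_def)

lemma grad_lipschitz: "norm (grad y - grad z) \<le> L * norm (y - z)"
  using smooth by (auto simp: L_smooth_def lipschitz_on_def dist_norm)

lemma grad_measurable: "grad \<in> borel_measurable borel"
proof -
  have "continuous_on UNIV grad"
    using smooth unfolding L_smooth_def by (auto intro: lipschitz_on_continuous_on)
  then show ?thesis by (rule borel_measurable_continuous_onI)
qed

lemma grad_eq_avg: "grad y = avg H (\<lambda>i. gradient (f i) y)"
  by (rule gradient_global_objective[OF f_differentiable])

lemma dissimilarity_avg:
  "avg H (\<lambda>i. (norm (gradient (f i) y - grad y))\<^sup>2) \<le> G\<^sup>2 + B\<^sup>2 * (norm (grad y))\<^sup>2"
  using dissimilarity by (simp add: bounded_dissimilarity_def avg_real)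

subsection \<open>The steps of the algorithm\<close>

lemma x_0: "\<omega> \<in> space M \<Longrightarrow> x 0 \<omega> = x0"
  using run by (simp add: rdsgdm_def)

lemma m_0: "\<omega> \<in> space M \<Longrightarrow> i \<in> H \<Longrightarrow> m 0 i \<omega> = 0"
  using run by (simp add: rdsgdm_def)

lemma m_Suc:
  assumes "\<omega> \<in> space M" "i \<in> H"
  shows "m (Suc t) i \<omega> = \<beta> *\<^sub>R m t i \<omega> + (1 - \<beta>) *\<^sub>R (gradient (f i) (x t \<omega>) + noise t i \<omega>)"
  using run[OF assms(1), unfolded rdsgdm_def, THEN conjunct2, THEN conjunct2, rule_format, of "Suc t"]
    assms(2) by (simp add: noise_def)

lemma x_Suc: "\<omega> \<in> space M \<Longrightarrow> x (Suc t) \<omega> = x t \<omega> - \<gamma> *\<^sub>R A (\<chi> i. m (Suc t) i \<omega>)"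
  using run[unfolded rdsgdm_def, THEN conjunct2, THEN conjunct2, rule_format, of \<omega> "Suc t"] by simp

lemma mean_momentum_0: "\<omega> \<in> space M \<Longrightarrow> mean_momentum 0 \<omega> = 0"
  by (simp add: mean_momentum_def avg_def m_0)

lemma mean_momentum_Suc:
  assumes "\<omega> \<in> space M"
  shows "mean_momentum (Suc t) \<omega>
    = \<beta> *\<^sub>R mean_momentum t \<omega> + (1 - \<beta>) *\<^sub>R (grad (x t \<omega>) + avg H (\<lambda>i. noise t i \<omega>))"
proof -
  have "mean_momentum (Suc t) \<omega> = avg H (\<lambda>i. \<beta> *\<^sub>R m t i \<omega>
      + (1 - \<beta>) *\<^sub>R (gradient (f i) (x t \<omega>) + noise t i \<omega>))"
    unfolding mean_momentum_def avg_def by (simp add: m_Suc[OF assms] cong: sum.cong)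
  then show ?thesis
    by (simp only: avg_add avg_scaleR mean_momentum_def grad_eq_avg)
qed

lemma aggregation_error:
  "(norm (A (\<chi> i. m t i \<omega>) - mean_momentum t \<omega>))\<^sup>2 \<le> \<kappa> * dispersion t \<omega>"
proof -
  have "(norm (A X - avg H (\<lambda>i. X $ i)))\<^sup>2
      \<le> \<kappa> * avg H (\<lambda>i. (norm (X $ i - avg H (\<lambda>i. X $ i)))\<^sup>2)" for X
    using robust[unfolded robust_aggregation_def Let_def, THEN conjunct2, THEN conjunct2,
        rule_format, of H X] card_H
    by (simp add: avg_def)
  from this[of "\<chi> i. m t i \<omega>"] show ?thesis by (simp add: mean_momentum_def dispersion_def)
qed

subsection \<open>The noise of the stochastic gradients\<close>

lemma F_subalgebra: "subalgebra M (F t)"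
  using samples by (simp add: fresh_samples_def)

lemma measurable_F_Suc: "u \<in> borel_measurable (F t) \<Longrightarrow> u \<in> borel_measurable (F (Suc t))"
  for u :: "'w \<Rightarrow> real ^ 'd"
proof -
  assume u: "u \<in> borel_measurable (F t)"
  have "sets (F t) \<subseteq> sets (F (Suc t))"
    using samples unfolding fresh_samples_def filtration_def by simp
  moreover have "space (F t) = space (F (Suc t))"
    using F_subalgebra unfolding subalgebra_def by metis
  ultimately show ?thesis
    using u by (intro measurable_mono[THEN subsetD, OF order_refl refl _ _ u]) simp_all
qed

lemma measurable_F_imp_M: "u \<in> measurable (F t) S \<Longrightarrow> u \<in> measurable M S"
  by (rule measurable_from_subalg[OF F_subalgebra])

lemma x_adapted: "x t \<in> borel_measurable (F t)"
  using adapted by (simp add: adapted_iterates_def)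

lemma sample_measurable:
  assumes "i \<in> H" shows "\<xi> (Suc t) i \<in> measurable (F (Suc t)) (D i)"
  using samples assms by (simp add: fresh_samples_def)

lemma sample_distr: assumes "i \<in> H" shows "distr M (D i) (\<xi> (Suc t) i) = D i"
  using samples assms by (simp add: fresh_samples_def)

lemma prob_space_D: assumes "i \<in> H" shows "prob_space (D i)"
  using prob_space_distr[OF measurable_F_imp_M[OF sample_measurable[OF assms]]] sample_distr[OF assms]
  by metis

lemma g_measurable:
  assumes "i \<in> H" shows "(\<lambda>p. g i (fst p) (snd p)) \<in> borel_measurable (borel \<Otimes>\<^sub>M D i)"
  using first_order assms by (simp add: stochastic_oracle_def case_prod_beta')

lemma local_gradient_measurable:
  assumes "i \<in> H" shows "gradient (f i) \<in> borel_measurable borel"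
proof -
  interpret D: prob_space "D i" by (rule prob_space_D) fact
  have "gradient (f i) = (\<lambda>y. \<integral>z. g i y z \<partial>D i)"
    using first_order assms by (simp add: stochastic_oracle_def fun_eq_iff)
  moreover have "(\<lambda>y. \<integral>z. g i y z \<partial>D i) \<in> borel_measurable borel"
    using D.borel_measurable_lebesgue_integral[of "\<lambda>y z. g i y z" borel] g_measurable[OF assms]
    by (simp add: case_prod_beta')
  ultimately show ?thesis by simp
qed

abbreviation sample_vector :: "nat \<Rightarrow> 'w \<Rightarrow> 'n \<Rightarrow> 'x" where
  "sample_vector t \<omega> \<equiv> \<lambda>i\<in>H. \<xi> (Suc t) i \<omega>"

abbreviation noise_at :: "'n \<Rightarrow> (real ^ 'd) \<times> ('n \<Rightarrow> 'x) \<Rightarrow> real ^ 'd" where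
  "noise_at i p \<equiv> g i (fst p) (snd p i) - gradient (f i) (fst p)"

lemma noise_at_measurable:
  assumes "i \<in> H" shows "noise_at i \<in> borel_measurable (borel \<Otimes>\<^sub>M Pi\<^sub>M H D)"
proof -
  note [measurable] = local_gradient_measurable[OF assms]
  have "(\<lambda>p. (fst p, snd p i)) \<in> measurable (borel \<Otimes>\<^sub>M Pi\<^sub>M H D) (borel \<Otimes>\<^sub>M D i)"
    using assms by measurable
  from measurable_compose[OF this g_measurable[OF assms]]
  have [measurable]: "(\<lambda>p. g i (fst p) (snd p i)) \<in> borel_measurable (borel \<Otimes>\<^sub>M Pi\<^sub>M H D)"
    by simp
  show ?thesis by measurable
qed

lemma sample_vector_indep:
  assumes "X \<in> measurable (F t) S"
  shows "indep_pair S X (Pi\<^sub>M H D) (sample_vector t)"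
proof (rule indep_pairI[OF F_subalgebra _ assms])
  show "indep_set (sets (F t)) (sets (vimage_algebra (space M) (sample_vector t) (Pi\<^sub>M H D)))"
    using samples unfolding fresh_samples_def by (elim conjE allE[of _ "Suc t"]) simp
  show "sample_vector t \<in> measurable M (Pi\<^sub>M H D)"
    using measurable_F_imp_M[OF sample_measurable] by (rule measurable_restrict)
qed

lemma noise_at_fixed_point:
  fixes y :: "real ^ 'd" and t :: nat
  assumes "i \<in> H"
  defines "W \<equiv> \<lambda>\<omega>. g i y (\<xi> (Suc t) i \<omega>) - gradient (f i) y"
  shows "integrable M W" "(\<integral>\<omega>. W \<omega> \<partial>M) = 0" "square_integrable M W"
    "(\<integral>\<omega>. (norm (W \<omega>))\<^sup>2 \<partial>M) \<le> \<sigma>\<^sup>2"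
proof -
  have \<xi>[measurable]: "\<xi> (Suc t) i \<in> measurable M (D i)"
    using measurable_F_imp_M[OF sample_measurable[OF assms(1)]] .
  have int: "integrable (D i) (g i y)" "integrable (D i) (\<lambda>z. (norm (g i y z - gradient (f i) y))\<^sup>2)"
    and mean: "(\<integral>z. g i y z \<partial>D i) = gradient (f i) y"
    and var: "(\<integral>z. (norm (g i y z - gradient (f i) y))\<^sup>2 \<partial>D i) \<le> \<sigma>\<^sup>2"
    using first_order assms(1) by (simp_all add: stochastic_oracle_def)
  have [measurable]: "g i y \<in> borel_measurable (D i)"
    using int(1) by (rule borel_measurable_integrable)
  have int_M: "integrable M (\<lambda>\<omega>. u (\<xi> (Suc t) i \<omega>))"
    and eq_M: "(\<integral>\<omega>. u (\<xi> (Suc t) i \<omega>) \<partial>M) = (\<integral>z. u z \<partial>D i)"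
    if "integrable (D i) u" for u :: "'x \<Rightarrow> 'v::euclidean_space"
    using integrable_distr[OF \<xi>, of u] integral_distr[OF \<xi>, of u] that
    by (simp_all add: sample_distr[OF assms(1)])
  show W: "integrable M W" unfolding W_def using int_M[OF int(1)] by simp
  show "(\<integral>\<omega>. W \<omega> \<partial>M) = 0"
    unfolding W_def using int_M[OF int(1)] by (simp add: eq_M[OF int(1)] mean prob_space)
  show "square_integrable M W"
    using int_M[OF int(2)] W by (auto simp: square_integrable_def W_def)
  show "(\<integral>\<omega>. (norm (W \<omega>))\<^sup>2 \<partial>M) \<le> \<sigma>\<^sup>2"
    unfolding W_def using eq_M[OF int(2)] var by simp
qed

lemma noise_second_moment:
  assumes "i \<in> H"
  shows "square_integrable M (noise t i)" "(\<integral>\<omega>. (norm (noise t i \<omega>))\<^sup>2 \<partial>M) \<le> \<sigma>\<^sup>2"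
  using second_moment_indep_pair_le[OF sample_vector_indep[OF x_adapted] noise_at_measurable[OF assms],
      of t "\<sigma>\<^sup>2"] noise_at_fixed_point(3,4)[OF assms] assms
  by (simp_all add: noise_def[abs_def])

text \<open>
  At the random iterate the noises of different workers are independent only conditionally on the
  past. Freezing the iterate at a point \<open>y\<close> makes them independent, and the resulting bound does not
  depend on \<open>y\<close>.
\<close>

lemma noise_avg_second_moment:
  "(\<integral>\<omega>. (norm (avg H (\<lambda>i. noise t i \<omega>)))\<^sup>2 \<partial>M) \<le> \<sigma>\<^sup>2 / real (card H)"
proof -
  let ?N = "\<lambda>p. avg H (\<lambda>i. noise_at i p)"
  have meas: "?N \<in> borel_measurable (borel \<Otimes>\<^sub>M Pi\<^sub>M H D)"
    unfolding avg_def by (intro borel_measurable_scaleR borel_measurable_const borel_measurable_sum noise_at_measurable)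
  have N_eq: "?N (y, sample_vector t \<omega>) = avg H (\<lambda>i. g i y (\<xi> (Suc t) i \<omega>) - gradient (f i) y)"
    for y \<omega> by (simp add: avg_def)
  have si: "square_integrable M (\<lambda>\<omega>. ?N (y, sample_vector t \<omega>))" for y
    unfolding N_eq by (intro square_integrable_avg noise_at_fixed_point)
  have le: "(\<integral>\<omega>. (norm (?N (y, sample_vector t \<omega>)))\<^sup>2 \<partial>M) \<le> \<sigma>\<^sup>2 / real (card H)" for y
  proof -
    let ?W = "\<lambda>i \<omega>. g i y (\<xi> (Suc t) i \<omega>) - gradient (f i) y"
    have "indep_vars (\<lambda>_. borel) (\<lambda>i \<omega>. g i y (\<xi> (Suc t) i \<omega>)) H"
      using independence by (simp add: independent_gradients_def)
    then have "indep_vars (\<lambda>_. borel) ?W H"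
      by (rule indep_vars_compose2) simp
    then have "(\<integral>\<omega>. (norm (\<Sum>i\<in>H. ?W i \<omega>))\<^sup>2 \<partial>M) \<le> real (card H) * \<sigma>\<^sup>2"
      by (rule integral_norm_sq_sum_indep_le) (simp_all add: noise_at_fixed_point)
    then have "(1 / real (card H))\<^sup>2 * (\<integral>\<omega>. (norm (\<Sum>i\<in>H. ?W i \<omega>))\<^sup>2 \<partial>M)
        \<le> (1 / real (card H))\<^sup>2 * (real (card H) * \<sigma>\<^sup>2)"
      by (intro mult_left_mono) auto
    also have "\<dots> = \<sigma>\<^sup>2 / real (card H)"
      using card_H_pos by (simp add: power2_eq_square)
    finally show ?thesis
      unfolding N_eq by (simp add: avg_def power_divide)
  qed
  show ?thesis
    using second_moment_indep_pair_le(2)[OF sample_vector_indep[OF x_adapted] meas si le]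
    by (simp add: noise_def avg_def)
qed

lemma noise_orthogonal:
  assumes "i \<in> H" "V \<in> borel_measurable (F t)" "square_integrable M V"
  shows "(\<integral>\<omega>. inner (V \<omega>) (noise t i \<omega>) \<partial>M) = 0"
proof -
  have "(\<lambda>\<omega>. (V \<omega>, x t \<omega>)) \<in> measurable (F t) (borel \<Otimes>\<^sub>M borel)"
    using assms(2) x_adapted by (rule measurable_Pair)
  note indep = sample_vector_indep[OF this]
  have "(\<lambda>p. (snd (fst p), snd p)) \<in> measurable ((borel \<Otimes>\<^sub>M borel) \<Otimes>\<^sub>M Pi\<^sub>M H D) (borel \<Otimes>\<^sub>M Pi\<^sub>M H D)"
    by measurable
  from measurable_compose[OF this noise_at_measurable[OF assms(1)]]
  have "(\<lambda>p. noise_at i (snd (fst p), snd p)) \<in> borel_measurable ((borel \<Otimes>\<^sub>M borel) \<Otimes>\<^sub>M Pi\<^sub>M H D)" .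
  from integral_inner_indep_pair_centered[OF indep measurable_fst this]
  show ?thesis
    using assms(1,3) noise_second_moment(1)[OF assms(1), of t] noise_at_fixed_point(1,2)[OF assms(1)]
    by (simp add: noise_def[abs_def])
qed

subsection \<open>Square integrability of the iterates\<close>

lemma m_measurable: "i \<in> H \<Longrightarrow> m t i \<in> borel_measurable (F t)"
proof (induction t)
  have space: "space (F t) = space M" for t
    using F_subalgebra by (simp add: subalgebra_def)
  {
    case 0
    then have "m 0 i \<in> borel_measurable (F 0) \<longleftrightarrow> (\<lambda>_. 0 :: real ^ 'd) \<in> borel_measurable (F 0)"
      by (intro measurable_cong) (simp add: space m_0)
    then show ?case by simp
  next
    case (Suc t)
    note [measurable] = measurable_F_Suc[OF Suc.IH[OF Suc.prems]] measurable_F_Suc[OF x_adapted]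
      local_gradient_measurable[OF Suc.prems] sample_measurable[OF Suc.prems]
    have [measurable]: "(\<lambda>\<omega>. g i (x t \<omega>) (\<xi> (Suc t) i \<omega>)) \<in> borel_measurable (F (Suc t))"
      using measurable_compose[OF measurable_Pair g_measurable[OF Suc.prems],
          of "x t" "F (Suc t)" "\<xi> (Suc t) i"] by simp
    have "m (Suc t) i \<in> borel_measurable (F (Suc t)) \<longleftrightarrow>
        (\<lambda>\<omega>. \<beta> *\<^sub>R m t i \<omega> + (1 - \<beta>) *\<^sub>R g i (x t \<omega>) (\<xi> (Suc t) i \<omega>)) \<in> borel_measurable (F (Suc t))"
      using Suc.prems by (intro measurable_cong) (simp add: space m_Suc noise_def)
    then show ?case by simp
  }
qed

text \<open>
  The two hypotheses that control growth are used here: the Lipschitz bound transfers square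
  integrability from the iterate to the global gradient, and bounded dissimilarity transfers it
  from the global gradient to each local one.
\<close>

lemma square_integrable_grad:
  assumes "square_integrable M (x t)"
  shows "square_integrable M (\<lambda>\<omega>. grad (x t \<omega>))"
proof (rule square_integrable_bound)
  note [measurable] = grad_measurable square_integrable_measurable[OF assms]
  show "(\<lambda>\<omega>. grad (x t \<omega>)) \<in> borel_measurable M" by measurable
  show "integrable M (\<lambda>\<omega>. 2 * (norm (grad 0))\<^sup>2 + 2 * (L\<^sup>2 * (norm (x t \<omega>))\<^sup>2))"
    using square_integrable_integrable[OF assms] by simp
  fix \<omega>
  have "norm (grad (x t \<omega>) - grad 0) \<le> L * norm (x t \<omega>)"
    using grad_lipschitz[of "x t \<omega>" 0] by simp
  then have "(norm (grad (x t \<omega>) - grad 0))\<^sup>2 \<le> L\<^sup>2 * (norm (x t \<omega>))\<^sup>2"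
    by (metis norm_ge_zero power_mono power_mult_distrib)
  then show "(norm (grad (x t \<omega>)))\<^sup>2 \<le> 2 * (norm (grad 0))\<^sup>2 + 2 * (L\<^sup>2 * (norm (x t \<omega>))\<^sup>2)"
    using norm_sq_add_le[of "grad 0" "grad (x t \<omega>) - grad 0"] by simp
qed

lemma square_integrable_local_gradient_diff:
  assumes "square_integrable M (x t)" "i \<in> H"
  shows "square_integrable M (\<lambda>\<omega>. gradient (f i) (x t \<omega>) - grad (x t \<omega>))"
proof (rule square_integrable_bound)
  note [measurable] = grad_measurable local_gradient_measurable[OF assms(2)]
    square_integrable_measurable[OF assms(1)]
  show "(\<lambda>\<omega>. gradient (f i) (x t \<omega>) - grad (x t \<omega>)) \<in> borel_measurable M" by measurable
  show "integrable M (\<lambda>\<omega>. real (card H) * (G\<^sup>2 + B\<^sup>2 * (norm (grad (x t \<omega>)))\<^sup>2))"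
    using square_integrable_integrable[OF square_integrable_grad[OF assms(1)]] by simp
  fix \<omega>
  let ?q = "\<lambda>i. (norm (gradient (f i) (x t \<omega>) - grad (x t \<omega>)))\<^sup>2"
  have "?q i \<le> (\<Sum>i\<in>H. ?q i)"
    using assms(2) by (intro member_le_sum) auto
  also have "\<dots> = real (card H) * avg H ?q"
    using card_H_pos by (simp add: avg_real)
  also have "\<dots> \<le> real (card H) * (G\<^sup>2 + B\<^sup>2 * (norm (grad (x t \<omega>)))\<^sup>2)"
    by (intro mult_left_mono dissimilarity_avg) simp
  finally show "?q i \<le> real (card H) * (G\<^sup>2 + B\<^sup>2 * (norm (grad (x t \<omega>)))\<^sup>2)" .
qed

lemma square_integrable_mean_momentum:
  "(\<And>i. i \<in> H \<Longrightarrow> square_integrable M (m t i)) \<Longrightarrow> square_integrable M (mean_momentum t)"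
  unfolding mean_momentum_def[abs_def] by (rule square_integrable_avg)

lemma integrable_dispersion:
  assumes "\<And>i. i \<in> H \<Longrightarrow> square_integrable M (m t i)"
  shows "integrable M (dispersion t)"
  unfolding dispersion_def[abs_def] avg_real
  by (intro integrable_divide_zero Bochner_Integration.integrable_sum impI
      square_integrable_integrable square_integrable_diff assms square_integrable_mean_momentum)

text \<open>
  The aggregate is measurable because it is a difference of consecutive iterates, and it is square
  integrable because robustness keeps it close to the mean of the honest momenta.
\<close>

lemma square_integrable_iterates:
  "square_integrable M (x t)" "i \<in> H \<Longrightarrow> square_integrable M (m t i)"
proof -
  have "square_integrable M (x t) \<and> (\<forall>i\<in>H. square_integrable M (m t i))"
  proof (induction t)
    case 0
    have "square_integrable M (x 0) \<longleftrightarrow> square_integrable M (\<lambda>_. x0)"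
      by (rule square_integrable_cong) (simp add: x_0)
    moreover have "square_integrable M (m 0 i) \<longleftrightarrow> square_integrable M (\<lambda>_. 0 :: real ^ 'd)"
      if "i \<in> H" for i using that by (intro square_integrable_cong) (simp add: m_0)
    ultimately show ?case
      by (simp add: square_integrable_const square_integrable_zero)
  next
    case (Suc t)
    have m: "square_integrable M (m (Suc t) i)" if i: "i \<in> H" for i
    proof -
      have "square_integrable M (\<lambda>\<omega>. \<beta> *\<^sub>R m t i \<omega> + (1 - \<beta>) *\<^sub>R
          (((gradient (f i) (x t \<omega>) - grad (x t \<omega>)) + grad (x t \<omega>)) + noise t i \<omega>))"
        using Suc.IH i
        by (intro square_integrable_add square_integrable_scaleR square_integrable_grad
            square_integrable_local_gradient_diff noise_second_moment) auto
      also have "?this \<longleftrightarrow> square_integrable M (m (Suc t) i)"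
        using i by (intro square_integrable_cong) (simp add: m_Suc)
      finally show ?thesis .
    qed
    define a where "a \<omega> = (1 / \<gamma>) *\<^sub>R (x t \<omega> - x (Suc t) \<omega>)" for \<omega>
    have a: "a \<omega> = A (\<chi> i. m (Suc t) i \<omega>)" if "\<omega> \<in> space M" for \<omega>
      using that \<gamma>_pos by (simp add: a_def x_Suc)
    note mean = square_integrable_mean_momentum[OF m]
    have "square_integrable M (\<lambda>\<omega>. a \<omega> - mean_momentum (Suc t) \<omega>)"
    proof (rule square_integrable_bound)
      note [measurable] = square_integrable_measurable[OF mean] measurable_F_imp_M[OF x_adapted]
      show "(\<lambda>\<omega>. a \<omega> - mean_momentum (Suc t) \<omega>) \<in> borel_measurable M"
        unfolding a_def by measurable
      show "integrable M (\<lambda>\<omega>. \<kappa> * dispersion (Suc t) \<omega>)"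
        using integrable_dispersion[OF m] by simp
      show "(norm (a \<omega> - mean_momentum (Suc t) \<omega>))\<^sup>2 \<le> \<kappa> * dispersion (Suc t) \<omega>"
        if "\<omega> \<in> space M" for \<omega> using aggregation_error[of "Suc t" \<omega>] a[OF that] by simp
    qed
    then have "square_integrable M (\<lambda>\<omega>. (a \<omega> - mean_momentum (Suc t) \<omega>) + mean_momentum (Suc t) \<omega>)"
      using mean by (rule square_integrable_add)
    then have "square_integrable M a" by simp
    then have "square_integrable M (\<lambda>\<omega>. x t \<omega> - \<gamma> *\<^sub>R a \<omega>)"
      using Suc.IH by (intro square_integrable_diff square_integrable_scaleR) auto
    also have "?this \<longleftrightarrow> square_integrable M (x (Suc t))"
      by (rule square_integrable_cong) (simp add: a x_Suc)
    finally show ?case using m by simp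
  qed
  then show "square_integrable M (x t)" "i \<in> H \<Longrightarrow> square_integrable M (m t i)" by auto
qed

lemmas square_integrable_grad_x = square_integrable_grad[OF square_integrable_iterates(1)]

lemma square_integrable_momentum_error: "square_integrable M (momentum_error t)"
  unfolding momentum_error_def[abs_def]
  by (intro square_integrable_diff square_integrable_mean_momentum square_integrable_iterates
      square_integrable_grad_x)

subsection \<open>The two error recursions\<close>

text \<open>
  Conditionally on the past, the fresh noise is centered, so it enters only through its second
  moment and with the square of \<open>1 - \<beta>\<close>. The momentum average therefore has variance of order
  \<open>(1 - \<beta>) \<sigma>\<^sup>2 / h\<close>, at the price of the drift of the gradient along the last step.
\<close>

lemma momentum_error_recursion:
  "(\<integral>\<omega>. (norm (momentum_error (Suc t) \<omega>))\<^sup>2 \<partial>M)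
    \<le> \<beta> * (\<integral>\<omega>. (norm (momentum_error t \<omega>))\<^sup>2 \<partial>M)
      + L\<^sup>2 / (1 - \<beta>) * (\<integral>\<omega>. (norm (x t \<omega> - x (t - 1) \<omega>))\<^sup>2 \<partial>M)
      + (1 - \<beta>)\<^sup>2 * (\<sigma>\<^sup>2 / real (card H))"
proof -
  define V where "V \<omega> = \<beta> *\<^sub>R (mean_momentum t \<omega> - grad (x t \<omega>))" for \<omega>
  define N where "N \<omega> = avg H (\<lambda>i. noise t i \<omega>)" for \<omega>
  note [measurable] = grad_measurable x_adapted[of t]
  have V_meas: "V \<in> borel_measurable (F t)"
  proof -
    have [measurable]: "mean_momentum t \<in> borel_measurable (F t)"
      unfolding mean_momentum_def[abs_def] avg_def
      by (intro borel_measurable_scaleR borel_measurable_const borel_measurable_sum m_measurable)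
    show ?thesis unfolding V_def[abs_def] by measurable
  qed
  have V: "square_integrable M V"
    unfolding V_def[abs_def]
    by (intro square_integrable_scaleR square_integrable_diff square_integrable_mean_momentum
        square_integrable_iterates square_integrable_grad_x)
  have N: "square_integrable M N"
    unfolding N_def[abs_def] by (intro square_integrable_avg noise_second_moment)
  have VN: "(\<integral>\<omega>. inner (V \<omega>) (N \<omega>) \<partial>M) = 0"
  proof -
    have "inner (V \<omega>) (N \<omega>) = (\<Sum>i\<in>H. inner (V \<omega>) (noise t i \<omega>)) / real (card H)" for \<omega>
      by (simp add: N_def avg_def inner_sum_right)
    then show ?thesis
      using noise_orthogonal[OF _ V_meas V] integrable_inner_square_integrable[OF V noise_second_moment(1)]
      by (simp add: Bochner_Integration.integral_sum)
  qed
  have pointwise: "(norm (V \<omega>))\<^sup>2 \<le> \<beta> * (norm (momentum_error t \<omega>))\<^sup>2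
      + L\<^sup>2 / (1 - \<beta>) * (norm (x t \<omega> - x (t - 1) \<omega>))\<^sup>2" for \<omega>
  proof -
    let ?d = "grad (x (t - 1) \<omega>) - grad (x t \<omega>)"
    have "V \<omega> = \<beta> *\<^sub>R (momentum_error t \<omega> + ?d)"
      by (simp add: V_def momentum_error_def)
    then have "(norm (V \<omega>))\<^sup>2 \<le> \<beta> * (norm (momentum_error t \<omega>))\<^sup>2 + (norm ?d)\<^sup>2 / (1 - \<beta>)"
      using norm_sq_young[OF \<beta>_nonneg \<beta>_less_1] by simp
    moreover have "(norm ?d)\<^sup>2 \<le> L\<^sup>2 * (norm (x t \<omega> - x (t - 1) \<omega>))\<^sup>2"
      using grad_lipschitz[of "x (t - 1) \<omega>" "x t \<omega>"]
      by (metis norm_ge_zero norm_minus_commute power_mono power_mult_distrib)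
    then have "(norm ?d)\<^sup>2 / (1 - \<beta>) \<le> L\<^sup>2 * (norm (x t \<omega> - x (t - 1) \<omega>))\<^sup>2 / (1 - \<beta>)"
      using \<beta>_less_1 by (intro divide_right_mono) auto
    ultimately show ?thesis by simp
  qed
  have step_int: "integrable M (\<lambda>\<omega>. (norm (x t \<omega> - x (t - 1) \<omega>))\<^sup>2)"
    by (intro square_integrable_integrable square_integrable_diff square_integrable_iterates)
  note err_int = square_integrable_integrable[OF square_integrable_momentum_error[of t]]
  have "(\<integral>\<omega>. (norm (momentum_error (Suc t) \<omega>))\<^sup>2 \<partial>M)
      = (\<integral>\<omega>. (norm (V \<omega> + (1 - \<beta>) *\<^sub>R N \<omega>))\<^sup>2 \<partial>M)"
    by (intro Bochner_Integration.integral_cong refl)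
      (simp add: momentum_error_def mean_momentum_Suc V_def N_def algebra_simps)
  also have "\<dots> = (\<integral>\<omega>. (norm (V \<omega>))\<^sup>2 \<partial>M) + (1 - \<beta>)\<^sup>2 * (\<integral>\<omega>. (norm (N \<omega>))\<^sup>2 \<partial>M)"
    by (rule integral_norm_sq_add_orthogonal[OF V N VN])
  also have "(\<integral>\<omega>. (norm (V \<omega>))\<^sup>2 \<partial>M) \<le> (\<integral>\<omega>. \<beta> * (norm (momentum_error t \<omega>))\<^sup>2
      + L\<^sup>2 / (1 - \<beta>) * (norm (x t \<omega> - x (t - 1) \<omega>))\<^sup>2 \<partial>M)"
    using step_int err_int square_integrable_integrable[OF V]
    by (intro integral_mono pointwise) auto
  also have "\<dots> = \<beta> * (\<integral>\<omega>. (norm (momentum_error t \<omega>))\<^sup>2 \<partial>M)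
      + L\<^sup>2 / (1 - \<beta>) * (\<integral>\<omega>. (norm (x t \<omega> - x (t - 1) \<omega>))\<^sup>2 \<partial>M)"
    using step_int err_int by simp
  also have "(1 - \<beta>)\<^sup>2 * (\<integral>\<omega>. (norm (N \<omega>))\<^sup>2 \<partial>M) \<le> (1 - \<beta>)\<^sup>2 * (\<sigma>\<^sup>2 / real (card H))"
    unfolding N_def by (intro mult_left_mono noise_avg_second_moment) simp
  finally show ?thesis by simp
qed

text \<open>
  Convexity suffices here in place of Young's inequality: the centered momenta are pulled towards
  the centered local gradients, whose mean square is exactly what bounded dissimilarity controls.
\<close>

lemma dispersion_recursion:
  "(\<integral>\<omega>. dispersion (Suc t) \<omega> \<partial>M) \<le> \<beta> * (\<integral>\<omega>. dispersion t \<omega> \<partial>M)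
    + (1 - \<beta>) * (G\<^sup>2 + B\<^sup>2 * (\<integral>\<omega>. (norm (grad (x t \<omega>)))\<^sup>2 \<partial>M)) + (1 - \<beta>)\<^sup>2 * \<sigma>\<^sup>2"
proof -
  define c where "c i \<omega> = m t i \<omega> - mean_momentum t \<omega>" for i \<omega>
  define e where "e i \<omega> = gradient (f i) (x t \<omega>) - grad (x t \<omega>)" for i \<omega>
  define V where "V i \<omega> = \<beta> *\<^sub>R c i \<omega> + (1 - \<beta>) *\<^sub>R e i \<omega>" for i \<omega>
  define N where "N i \<omega> = noise t i \<omega> - avg H (\<lambda>i. noise t i \<omega>)" for i \<omega>
  have V_meas: "V i \<in> borel_measurable (F t)" if "i \<in> H" for i
  proof -
    note [measurable] = grad_measurable x_adapted[of t] m_measurable[OF that]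
      local_gradient_measurable[OF that]
    have [measurable]: "mean_momentum t \<in> borel_measurable (F t)"
      unfolding mean_momentum_def[abs_def] avg_def
      by (intro borel_measurable_scaleR borel_measurable_const borel_measurable_sum m_measurable)
    show ?thesis unfolding V_def[abs_def] c_def e_def by measurable
  qed
  have c: "square_integrable M (c i)" and e: "square_integrable M (e i)" if "i \<in> H" for i
    unfolding c_def[abs_def] e_def[abs_def] using that
    by (auto intro!: square_integrable_diff square_integrable_mean_momentum
        square_integrable_iterates square_integrable_local_gradient_diff)
  then have V: "square_integrable M (V i)" if "i \<in> H" for i
    unfolding V_def[abs_def] using that by (intro square_integrable_add square_integrable_scaleR)
  have N: "square_integrable M (N i)" if "i \<in> H" for i
    unfolding N_def[abs_def] using that
    by (intro square_integrable_diff square_integrable_avg noise_second_moment)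
  have VN: "(\<integral>\<omega>. inner (V i \<omega>) (N i \<omega>) \<partial>M) = 0" if i: "i \<in> H" for i
  proof -
    have "inner (V i \<omega>) (N i \<omega>)
        = inner (V i \<omega>) (noise t i \<omega>) - (\<Sum>j\<in>H. inner (V i \<omega>) (noise t j \<omega>)) / real (card H)" for \<omega>
      by (simp add: N_def avg_def inner_sum_right inner_diff_right)
    then show ?thesis
      using noise_orthogonal[OF _ V_meas[OF i] V[OF i]] i
        integrable_inner_square_integrable[OF V[OF i] noise_second_moment(1)]
      by (simp add: Bochner_Integration.integral_sum)
  qed
  have integral_avg: "(\<integral>\<omega>. avg H (\<lambda>i. u i \<omega>) \<partial>M) = avg H (\<lambda>i. \<integral>\<omega>. u i \<omega> \<partial>M)"
    and integrable_avg: "integrable M (\<lambda>\<omega>. avg H (\<lambda>i. u i \<omega>))"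
    if "\<And>i. i \<in> H \<Longrightarrow> integrable M (u i)" for u :: "'n \<Rightarrow> 'w \<Rightarrow> real"
    using that by (simp_all add: avg_real Bochner_Integration.integral_sum)
  have sq_int: "integrable M (\<lambda>\<omega>. (norm (V i \<omega>))\<^sup>2)" "integrable M (\<lambda>\<omega>. (norm (N i \<omega>))\<^sup>2)"
      "integrable M (\<lambda>\<omega>. (norm (noise t i \<omega>))\<^sup>2)"
      "integrable M (\<lambda>\<omega>. (norm (V i \<omega> + (1 - \<beta>) *\<^sub>R N i \<omega>))\<^sup>2)" if "i \<in> H" for i
    using that by (auto intro!: square_integrable_integrable V N noise_second_moment
        square_integrable_add square_integrable_scaleR)
  have "(\<integral>\<omega>. dispersion (Suc t) \<omega> \<partial>M)
      = (\<integral>\<omega>. avg H (\<lambda>i. (norm (V i \<omega> + (1 - \<beta>) *\<^sub>R N i \<omega>))\<^sup>2) \<partial>M)"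
    unfolding dispersion_def avg_real
    by (intro Bochner_Integration.integral_cong refl arg_cong2[where f="(/)"] sum.cong)
      (simp add: mean_momentum_Suc m_Suc V_def N_def c_def e_def algebra_simps)
  also have "\<dots> = avg H (\<lambda>i. \<integral>\<omega>. (norm (V i \<omega> + (1 - \<beta>) *\<^sub>R N i \<omega>))\<^sup>2 \<partial>M)"
    by (rule integral_avg[OF sq_int(4)])
  also have "\<dots> = avg H (\<lambda>i. (\<integral>\<omega>. (norm (V i \<omega>))\<^sup>2 \<partial>M) + (1 - \<beta>)\<^sup>2 * (\<integral>\<omega>. (norm (N i \<omega>))\<^sup>2 \<partial>M))"
    unfolding avg_def using integral_norm_sq_add_orthogonal[OF V N VN] by simp
  also have "\<dots> = (\<integral>\<omega>. avg H (\<lambda>i. (norm (V i \<omega>))\<^sup>2) \<partial>M)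
      + (1 - \<beta>)\<^sup>2 * (\<integral>\<omega>. avg H (\<lambda>i. (norm (N i \<omega>))\<^sup>2) \<partial>M)"
    using sq_int by (simp add: avg_add avg_mult integral_avg)
  also have "(\<integral>\<omega>. avg H (\<lambda>i. (norm (V i \<omega>))\<^sup>2) \<partial>M)
      \<le> (\<integral>\<omega>. \<beta> * dispersion t \<omega> + (1 - \<beta>) * (G\<^sup>2 + B\<^sup>2 * (norm (grad (x t \<omega>)))\<^sup>2) \<partial>M)"
  proof (intro integral_mono integrable_avg sq_int)
    fix \<omega>
    have "avg H (\<lambda>i. (norm (V i \<omega>))\<^sup>2)
        \<le> avg H (\<lambda>i. \<beta> * (norm (c i \<omega>))\<^sup>2 + (1 - \<beta>) * (norm (e i \<omega>))\<^sup>2)"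
      unfolding V_def using \<beta>_nonneg \<beta>_less_1
      by (intro avg_mono norm_sq_convex) simp_all
    also have "\<dots> = \<beta> * dispersion t \<omega> + (1 - \<beta>) * avg H (\<lambda>i. (norm (e i \<omega>))\<^sup>2)"
      by (simp only: avg_add avg_mult dispersion_def c_def)
    also have "\<dots> \<le> \<beta> * dispersion t \<omega> + (1 - \<beta>) * (G\<^sup>2 + B\<^sup>2 * (norm (grad (x t \<omega>)))\<^sup>2)"
      unfolding e_def using \<beta>_less_1 by (intro add_left_mono mult_left_mono dissimilarity_avg) simp
    finally show "avg H (\<lambda>i. (norm (V i \<omega>))\<^sup>2)
        \<le> \<beta> * dispersion t \<omega> + (1 - \<beta>) * (G\<^sup>2 + B\<^sup>2 * (norm (grad (x t \<omega>)))\<^sup>2)" .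
  qed (use integrable_dispersion[OF square_integrable_iterates(2)]
      square_integrable_integrable[OF square_integrable_grad_x] in simp_all)
  also have "\<dots> = \<beta> * (\<integral>\<omega>. dispersion t \<omega> \<partial>M)
      + (1 - \<beta>) * (G\<^sup>2 + B\<^sup>2 * (\<integral>\<omega>. (norm (grad (x t \<omega>)))\<^sup>2 \<partial>M))"
    using integrable_dispersion[OF square_integrable_iterates(2)]
      square_integrable_integrable[OF square_integrable_grad_x] by (simp add: prob_space)
  also have "(\<integral>\<omega>. avg H (\<lambda>i. (norm (N i \<omega>))\<^sup>2) \<partial>M) \<le> \<sigma>\<^sup>2"
  proof -
    have "(\<integral>\<omega>. avg H (\<lambda>i. (norm (N i \<omega>))\<^sup>2) \<partial>M) \<le> (\<integral>\<omega>. avg H (\<lambda>i. (norm (noise t i \<omega>))\<^sup>2) \<partial>M)"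
      unfolding N_def using sq_int
      by (intro integral_mono integrable_avg avg_norm_sq_centered_le) (simp_all add: N_def)
    also have "\<dots> = avg H (\<lambda>i. \<integral>\<omega>. (norm (noise t i \<omega>))\<^sup>2 \<partial>M)"
      by (rule integral_avg[OF sq_int(3)])
    also have "\<dots> \<le> avg H (\<lambda>_. \<sigma>\<^sup>2)"
      by (intro avg_mono noise_second_moment)
    finally show ?thesis using card_H_pos[THEN gr_implies_not0] by (simp add: avg_const)
  qed
  finally show ?thesis by (simp add: mult_left_mono)
qed

subsection \<open>Summation over the steps\<close>

text \<open>
  Telescoping the function values before integrating leaves only the deterministic gap to the
  infimum on the right-hand side.
\<close>

lemma descent_sum:
  assumes "\<omega> \<in> space M" "bdd_below (range fH)"
  shows "(\<Sum>t<T. \<gamma> / 2 * (norm (grad (x t \<omega>)))\<^sup>2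
        + (1 - \<gamma> * L) / (2 * \<gamma>) * (norm (x (Suc t) \<omega> - x t \<omega>))\<^sup>2)
    \<le> fH x0 - (INF y. fH y)
      + (\<Sum>t<T. \<gamma> * ((norm (momentum_error (Suc t) \<omega>))\<^sup>2 + \<kappa> * dispersion (Suc t) \<omega>))"
proof -
  have step: "\<gamma> / 2 * (norm (grad (x t \<omega>)))\<^sup>2
        + (1 - \<gamma> * L) / (2 * \<gamma>) * (norm (x (Suc t) \<omega> - x t \<omega>))\<^sup>2
      \<le> fH (x t \<omega>) - fH (x (Suc t) \<omega>)
        + \<gamma> * ((norm (momentum_error (Suc t) \<omega>))\<^sup>2 + \<kappa> * dispersion (Suc t) \<omega>)" for t
  proof -
    define a where "a = A (\<chi> i. m (Suc t) i \<omega>)"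
    have x: "x (Suc t) \<omega> = x t \<omega> - \<gamma> *\<^sub>R a" using x_Suc[OF assms(1)] by (simp add: a_def)
    have "(norm (a - grad (x t \<omega>)))\<^sup>2
        \<le> 2 * (norm (a - mean_momentum (Suc t) \<omega>))\<^sup>2 + 2 * (norm (momentum_error (Suc t) \<omega>))\<^sup>2"
      using norm_sq_add_le[of "a - mean_momentum (Suc t) \<omega>" "momentum_error (Suc t) \<omega>"]
      by (simp add: momentum_error_def)
    also have "\<dots> \<le> 2 * (\<kappa> * dispersion (Suc t) \<omega>) + 2 * (norm (momentum_error (Suc t) \<omega>))\<^sup>2"
      using aggregation_error[of "Suc t" \<omega>] by (simp add: a_def)
    finally have "(norm (a - grad (x t \<omega>)))\<^sup>2 / 2
        \<le> (norm (momentum_error (Suc t) \<omega>))\<^sup>2 + \<kappa> * dispersion (Suc t) \<omega>" by simp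
    from mult_left_mono[OF this, of \<gamma>]
    have "\<gamma> / 2 * (norm (a - grad (x t \<omega>)))\<^sup>2
        \<le> \<gamma> * ((norm (momentum_error (Suc t) \<omega>))\<^sup>2 + \<kappa> * dispersion (Suc t) \<omega>)"
      using \<gamma>_pos by simp
    moreover have "(1 - \<gamma> * L) / (2 * \<gamma>) * (norm (x (Suc t) \<omega> - x t \<omega>))\<^sup>2
        = \<gamma> / 2 * (1 - \<gamma> * L) * (norm a)\<^sup>2"
      using \<gamma>_pos by (simp add: x power_mult_distrib power2_eq_square)
    ultimately show ?thesis
      using L_smooth_descent[OF smooth, of "x t \<omega>" \<gamma> a, folded x] by linarith
  qed
  have "(INF y. fH y) \<le> fH (x T \<omega>)" by (rule cINF_lower[OF assms(2)]) simp
  moreover have "(\<Sum>t<T. fH (x t \<omega>) - fH (x (Suc t) \<omega>)) = fH x0 - fH (x T \<omega>)"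
    using sum_lessThan_telescope'[of "\<lambda>t. fH (x t \<omega>)" T] x_0[OF assms(1)] by simp
  moreover have "(\<Sum>t<T. \<gamma> / 2 * (norm (grad (x t \<omega>)))\<^sup>2
        + (1 - \<gamma> * L) / (2 * \<gamma>) * (norm (x (Suc t) \<omega> - x t \<omega>))\<^sup>2)
      \<le> (\<Sum>t<T. fH (x t \<omega>) - fH (x (Suc t) \<omega>)
        + \<gamma> * ((norm (momentum_error (Suc t) \<omega>))\<^sup>2 + \<kappa> * dispersion (Suc t) \<omega>))"
    by (rule sum_mono) (rule step)
  ultimately show ?thesis by (simp only: sum.distrib)
qed

lemma expected_descent:
  assumes "bdd_below (range fH)"
  shows "\<gamma> / 2 * (\<Sum>t<T. \<integral>\<omega>. (norm (grad (x t \<omega>)))\<^sup>2 \<partial>M)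
      + (1 - \<gamma> * L) / (2 * \<gamma>) * (\<Sum>t<T. \<integral>\<omega>. (norm (x (Suc t) \<omega> - x t \<omega>))\<^sup>2 \<partial>M)
    \<le> fH x0 - (INF y. fH y)
      + \<gamma> * ((\<Sum>t<T. \<integral>\<omega>. (norm (momentum_error (Suc t) \<omega>))\<^sup>2 \<partial>M)
        + \<kappa> * (\<Sum>t<T. \<integral>\<omega>. dispersion (Suc t) \<omega> \<partial>M))"
proof -
  have int[simp]: "integrable M (\<lambda>\<omega>. (norm (grad (x t \<omega>)))\<^sup>2)"
      "integrable M (\<lambda>\<omega>. (norm (x (Suc t) \<omega> - x t \<omega>))\<^sup>2)"
      "integrable M (\<lambda>\<omega>. (norm (momentum_error t \<omega>))\<^sup>2)" "integrable M (dispersion t)" for t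
    by (intro square_integrable_integrable square_integrable_grad_x square_integrable_diff
        square_integrable_iterates square_integrable_momentum_error integrable_dispersion)+
  have "(\<integral>\<omega>. (\<Sum>t<T. \<gamma> / 2 * (norm (grad (x t \<omega>)))\<^sup>2
        + (1 - \<gamma> * L) / (2 * \<gamma>) * (norm (x (Suc t) \<omega> - x t \<omega>))\<^sup>2) \<partial>M)
    \<le> (\<integral>\<omega>. fH x0 - (INF y. fH y)
      + (\<Sum>t<T. \<gamma> * ((norm (momentum_error (Suc t) \<omega>))\<^sup>2 + \<kappa> * dispersion (Suc t) \<omega>)) \<partial>M)"
    by (intro integral_mono descent_sum assms) simp_all
  then show ?thesis
    by (simp add: Bochner_Integration.integral_sum prob_space sum.distrib sum_distrib_left distrib_left)
qed

text \<open>
  With \<open>1 - \<beta> = 36 \<gamma> L\<close> the summed drift term carries the factor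
  \<open>L\<^sup>2 / (1 - \<beta>)\<^sup>2 = 1 / (36 \<gamma>)\<^sup>2\<close> and is absorbed by the negative step-length term of the descent
  inequality; the initial error \<open>\<parallel>grad x0\<parallel>\<^sup>2\<close> costs \<open>1/18\<close> of the initial gap in function values.
\<close>

theorem gradient_sum_bound:
  assumes bdd: "bdd_below (range fH)" and small: "\<gamma> * L \<le> 1 / 36" and \<beta>: "\<beta> = 1 - 36 * \<gamma> * L"
  shows "(1 / 2 - \<kappa> * B\<^sup>2) * (\<Sum>t<T. \<integral>\<omega>. (norm (grad (x t \<omega>)))\<^sup>2 \<partial>M)
    \<le> 19 / 18 * (fH x0 - (INF y. fH y)) / \<gamma>
      + real T * ((36 * L / real (card H) + 36 * \<kappa> * L) * \<gamma> * \<sigma>\<^sup>2 + \<kappa> * G\<^sup>2)"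
proof -
  let ?\<alpha> = "36 * \<gamma> * L"
  let ?gap = "fH x0 - (INF y. fH y)"
  let ?SN = "\<Sum>t<T. \<integral>\<omega>. (norm (grad (x t \<omega>)))\<^sup>2 \<partial>M"
  define q where "q t = (\<integral>\<omega>. (norm (momentum_error t \<omega>))\<^sup>2 \<partial>M)" for t
  define p where "p t = (\<integral>\<omega>. dispersion t \<omega> \<partial>M)" for t
  define s where "s t = (\<integral>\<omega>. (norm (x t \<omega> - x (t - 1) \<omega>))\<^sup>2 \<partial>M)" for t
  define Q where "Q = (\<Sum>t<T. q (Suc t))"
  define P where "P = (\<Sum>t<T. p (Suc t))"
  define S where "S = (\<Sum>t<T. s (Suc t))"
  have \<alpha>: "0 < ?\<alpha>" "1 - \<beta> = ?\<alpha>" using \<gamma>_pos L_pos \<beta> by simp_all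
  have nonneg: "0 \<le> q t" "0 \<le> p t" "0 \<le> s t" for t
    by (simp_all add: q_def p_def s_def dispersion_def avg_real sum_nonneg)
  have shift: "(\<Sum>t<T. u t) = u 0 + (\<Sum>t<T. u (Suc t)) - u T" for u :: "nat \<Rightarrow> real"
    using sum.lessThan_Suc[of u T] sum.lessThan_Suc_shift[of u T] by simp
  have q_0: "q 0 = (norm (grad x0))\<^sup>2"
  proof -
    have "q 0 = (\<integral>\<omega>. (norm (grad x0))\<^sup>2 \<partial>M)"
      unfolding q_def by (intro Bochner_Integration.integral_cong refl)
        (simp add: momentum_error_def mean_momentum_0 x_0)
    then show ?thesis by (simp add: prob_space)
  qed
  have p_0: "p 0 = 0"
  proof -
    have "p 0 = (\<integral>\<omega>. 0 \<partial>M)"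
      unfolding p_def by (intro Bochner_Integration.integral_cong refl)
        (simp add: dispersion_def avg_real m_0 mean_momentum_0)
    then show ?thesis by simp
  qed
  have s_0: "s 0 = 0" by (simp add: s_def)

  \<comment> \<open>Summing a contraction with factor \<open>\<beta>\<close> divides the sum of the source terms by \<open>1 - \<beta>\<close>.\<close>
  have P_le: "P \<le> real T * G\<^sup>2 + B\<^sup>2 * ?SN + real T * (?\<alpha> * \<sigma>\<^sup>2)"
  proof -
    have "P \<le> (\<Sum>t<T. \<beta> * p t + ?\<alpha> * (G\<^sup>2 + B\<^sup>2 * (\<integral>\<omega>. (norm (grad (x t \<omega>)))\<^sup>2 \<partial>M)) + ?\<alpha>\<^sup>2 * \<sigma>\<^sup>2)"
      unfolding P_def p_def using dispersion_recursion by (intro sum_mono) (simp only: \<alpha>(2))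
    also have "\<dots> = \<beta> * (\<Sum>t<T. p t) + ?\<alpha> * (real T * G\<^sup>2 + B\<^sup>2 * ?SN) + real T * (?\<alpha>\<^sup>2 * \<sigma>\<^sup>2)"
      by (simp only: sum.distrib sum_distrib_left[symmetric] sum_constant card_lessThan
          mult.left_commute[of "real T"])
    also have "\<dots> \<le> \<beta> * P + ?\<alpha> * (real T * G\<^sup>2 + B\<^sup>2 * ?SN) + real T * (?\<alpha>\<^sup>2 * \<sigma>\<^sup>2)"
      unfolding P_def using shift[of p] nonneg(2)[of T] p_0 \<beta>_nonneg
      by (intro add_right_mono mult_left_mono) auto
    finally have "P \<le> \<beta> * P + ?\<alpha> * (real T * G\<^sup>2 + B\<^sup>2 * ?SN) + real T * (?\<alpha>\<^sup>2 * \<sigma>\<^sup>2)" .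
    then have "(1 - \<beta>) * P \<le> ?\<alpha> * (real T * G\<^sup>2 + B\<^sup>2 * ?SN) + real T * (?\<alpha>\<^sup>2 * \<sigma>\<^sup>2)"
      by (simp add: left_diff_distrib)
    then have "?\<alpha> * P \<le> ?\<alpha> * (real T * G\<^sup>2 + B\<^sup>2 * ?SN + real T * (?\<alpha> * \<sigma>\<^sup>2))"
      by (simp only: \<alpha>(2)) (simp add: distrib_left power2_eq_square mult_ac)
    then show ?thesis using \<alpha>(1) by (simp only: mult_le_cancel_left_pos)
  qed

  have Q_le: "\<gamma> * Q \<le> ?gap / 18 + S / (1296 * \<gamma>) + \<gamma> * (real T * (?\<alpha> * (\<sigma>\<^sup>2 / real (card H))))"
  proof -
    have "Q \<le> (\<Sum>t<T. \<beta> * q t + L\<^sup>2 / ?\<alpha> * s t + ?\<alpha>\<^sup>2 * (\<sigma>\<^sup>2 / real (card H)))"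
      unfolding Q_def q_def s_def using momentum_error_recursion by (intro sum_mono) (simp only: \<alpha>(2))
    also have "\<dots> = \<beta> * (\<Sum>t<T. q t) + L\<^sup>2 / ?\<alpha> * (\<Sum>t<T. s t) + real T * (?\<alpha>\<^sup>2 * (\<sigma>\<^sup>2 / real (card H)))"
      by (simp only: sum.distrib sum_distrib_left[symmetric] sum_constant card_lessThan
          mult.left_commute[of "real T"])
    also have "\<dots> \<le> \<beta> * (q 0 + Q) + L\<^sup>2 / ?\<alpha> * S + real T * (?\<alpha>\<^sup>2 * (\<sigma>\<^sup>2 / real (card H)))"
      unfolding Q_def S_def using shift[of q] shift[of s] nonneg(1,3)[of T] s_0 \<alpha>(1) \<beta>_nonneg
      by (intro add_mono mult_left_mono) auto
    finally have "(1 - \<beta>) * Q \<le> \<beta> * q 0 + L\<^sup>2 / ?\<alpha> * S + real T * (?\<alpha>\<^sup>2 * (\<sigma>\<^sup>2 / real (card H)))"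
      by (simp add: distrib_left left_diff_distrib)
    also have "\<beta> * q 0 \<le> 1 * (2 * L * ?gap)"
      unfolding q_0 using \<beta>_less_1
      by (intro mult_mono L_smooth_gradient_bound[OF smooth bdd]) auto
    finally have "?\<alpha> * Q \<le> 2 * L * ?gap + L\<^sup>2 / ?\<alpha> * S + real T * (?\<alpha>\<^sup>2 * (\<sigma>\<^sup>2 / real (card H)))"
      by (simp only: \<alpha>(2)) simp
    then have "(?\<alpha> * Q) / (36 * L)
        \<le> (2 * L * ?gap + L\<^sup>2 / ?\<alpha> * S + real T * (?\<alpha>\<^sup>2 * (\<sigma>\<^sup>2 / real (card H)))) / (36 * L)"
      using L_pos by (intro divide_right_mono) auto
    also have "\<dots> = ?gap / 18 + S / (1296 * \<gamma>) + \<gamma> * (real T * (?\<alpha> * (\<sigma>\<^sup>2 / real (card H))))"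
      using L_pos \<gamma>_pos card_H_pos by (simp add: add_divide_distrib power2_eq_square) (simp add: field_simps)
    finally show ?thesis using L_pos by simp
  qed

  \<comment> \<open>\<open>z\<close> is the step-length term that absorbs the drift \<open>u\<close>; \<open>n\<close> is the part of the dispersion
      proportional to the gradient sum \<open>a\<close>.\<close>
  have combine: "a - n \<le> 19 / 18 * d + (c + e)"
    if "a + z \<le> d + w" "u \<le> z" "y \<le> n + e" "v \<le> d / 18 + u + c" "w = v + y"
    for a c d e n u v w y z :: real
    using that by linarith
  have "\<gamma> / 2 * ?SN + (1 - \<gamma> * L) / (2 * \<gamma>) * S \<le> ?gap + \<gamma> * (Q + \<kappa> * P)"
    using expected_descent[OF bdd, of T] by (simp add: Q_def q_def P_def p_def S_def s_def)
  moreover have "S / (1296 * \<gamma>) \<le> (1 - \<gamma> * L) / (2 * \<gamma>) * S"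
  proof -
    have "0 \<le> S" unfolding S_def by (intro sum_nonneg nonneg)
    then have "1 / 648 * (S / (2 * \<gamma>)) \<le> (1 - \<gamma> * L) * (S / (2 * \<gamma>))"
      using \<gamma>_pos small by (intro mult_right_mono) auto
    then show ?thesis by simp
  qed
  moreover have "\<gamma> * (\<kappa> * P)
      \<le> \<gamma> * (\<kappa> * (B\<^sup>2 * ?SN)) + \<gamma> * (\<kappa> * (real T * G\<^sup>2 + real T * (?\<alpha> * \<sigma>\<^sup>2)))"
    using \<gamma>_pos \<kappa>_pos P_le unfolding distrib_left[symmetric]
    by (intro mult_left_mono) (auto simp: distrib_left)
  ultimately have "\<gamma> / 2 * ?SN - \<gamma> * (\<kappa> * (B\<^sup>2 * ?SN)) \<le> 19 / 18 * ?gap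
      + (\<gamma> * (real T * (?\<alpha> * (\<sigma>\<^sup>2 / real (card H)))) + \<gamma> * (\<kappa> * (real T * G\<^sup>2 + real T * (?\<alpha> * \<sigma>\<^sup>2))))"
    by (rule combine[OF _ _ _ Q_le distrib_left])
  also have "\<gamma> / 2 * ?SN - \<gamma> * (\<kappa> * (B\<^sup>2 * ?SN)) = \<gamma> * ((1 / 2 - \<kappa> * B\<^sup>2) * ?SN)"
    by (simp add: algebra_simps)
  also have "19 / 18 * ?gap = \<gamma> * (19 / 18 * ?gap / \<gamma>)"
    using \<gamma>_pos by simp
  also have "\<gamma> * (real T * (?\<alpha> * (\<sigma>\<^sup>2 / real (card H)))) + \<gamma> * (\<kappa> * (real T * G\<^sup>2 + real T * (?\<alpha> * \<sigma>\<^sup>2)))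
      = \<gamma> * (real T * ((36 * L / real (card H) + 36 * \<kappa> * L) * \<gamma> * \<sigma>\<^sup>2 + \<kappa> * G\<^sup>2))"
    by (simp add: algebra_simps)
  finally have "\<gamma> * ((1 / 2 - \<kappa> * B\<^sup>2) * ?SN) \<le> \<gamma> * (19 / 18 * ?gap / \<gamma>
      + real T * ((36 * L / real (card H) + 36 * \<kappa> * L) * \<gamma> * \<sigma>\<^sup>2 + \<kappa> * G\<^sup>2))"
    by (simp only: distrib_left)
  then show ?thesis using \<gamma>_pos by (simp only: mult_le_cancel_left_pos)
qed

end

section \<open>The convergence rate\<close>

theorem theoremB7:
  fixes H :: "'n::finite set"
    and A :: "real ^ 'd ^ 'n \<Rightarrow> real ^ 'd"
    and loss :: "real ^ 'd \<Rightarrow> 'x \<Rightarrow> real"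
    and D :: "'n \<Rightarrow> 'x measure"
    and g :: "'n \<Rightarrow> real ^ 'd \<Rightarrow> 'x \<Rightarrow> real ^ 'd"
    and f :: "'n \<Rightarrow> real ^ 'd \<Rightarrow> real"
    and fH :: "real ^ 'd \<Rightarrow> real"
    and M :: "'w measure"
    and F :: "nat \<Rightarrow> 'w measure"
    and \<xi> :: "nat \<Rightarrow> 'n \<Rightarrow> 'w \<Rightarrow> 'x"
    and m :: "nat \<Rightarrow> 'n \<Rightarrow> 'w \<Rightarrow> real ^ 'd"
    and x :: "nat \<Rightarrow> 'w \<Rightarrow> real ^ 'd"
    and x0 :: "real ^ 'd"
    and b h T :: nat
    and L G B \<sigma> \<kappa> \<gamma> \<beta> :: real
  defines "f \<equiv> local_objective loss D"
    and "fH \<equiv> global_objective f H"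
  assumes b: "2 * b < CARD('n)"
    and h: "h = CARD('n) - b"
    and H: "card H = h"
    and loss_integrable: "\<And>i y. i \<in> H \<Longrightarrow> integrable (D i) (loss y)"
    and f_differentiable: "\<And>i y. i \<in> H \<Longrightarrow> f i differentiable (at y)"
    and fH_bdd_below: "bdd_below (range fH)"
    and smooth: "L_smooth L fH"
    and dissimilarity: "bounded_dissimilarity G B f H"
    and first_order: "stochastic_oracle \<sigma> D g f H"
    and robust: "robust_aggregation b \<kappa> A"
    and samples: "fresh_samples M F D H \<xi>"
    and independence: "independent_gradients M g H \<xi>"
    and kappa: "\<kappa> * B\<^sup>2 < 1 / 56"
    and gamma: "0 < \<gamma> * L" "\<gamma> * L \<le> 1 / 36"
    and beta: "\<beta> = 1 - 36 * \<gamma> * L"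
    and run: "\<forall>\<omega>\<in>space M.
      rdsgdm A g H (\<lambda>_. \<gamma>) (\<lambda>_. \<beta>) x0 (\<lambda>t i. \<xi> t i \<omega>) (\<lambda>t i. m t i \<omega>) (\<lambda>t. x t \<omega>)"
    and adapted: "adapted_iterates F x"
    and T: "1 \<le> T"
  shows "(\<forall>t<T. integrable M (\<lambda>\<omega>. (norm (gradient fH (x t \<omega>)))\<^sup>2)) \<and>
    1 / real T * (\<Sum>t<T. \<integral>\<omega>. (norm (gradient fH (x t \<omega>)))\<^sup>2 \<partial>M)
      \<le> 9 * (fH x0 - (INF y. fH y)) / (4 * (3 / 8 - 21 * \<kappa> * B\<^sup>2) * \<gamma> * real T)
        + (162 * L / real h + 756 * \<kappa> * L) / (3 / 8 - 21 * \<kappa> * B\<^sup>2) * \<gamma> * \<sigma>\<^sup>2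
        + 21 * \<kappa> * G\<^sup>2 / (3 / 8 - 21 * \<kappa> * B\<^sup>2)"
proof -
  have L: "0 < L" using smooth by (simp add: L_smooth_def)
  then have \<gamma>: "0 < \<gamma>" using gamma(1) by (simp add: zero_less_mult_iff)
  have \<beta>: "0 \<le> \<beta>" "\<beta> < 1" using gamma unfolding beta by linarith+
  interpret prob_space M using samples by (simp add: fresh_samples_def)
  interpret byzantine_momentum M H A D g f F \<xi> m x x0 b L G B \<sigma> \<kappa> \<gamma> \<beta>
    using h H f_differentiable smooth dissimilarity first_order robust samples independence
      run adapted \<gamma> \<beta> unfolding fH_def
    by unfold_locales blast+
  let ?S = "\<Sum>t<T. \<integral>\<omega>. (norm (gradient fH (x t \<omega>)))\<^sup>2 \<partial>M"
  let ?gap = "fH x0 - (INF y. fH y)"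
  let ?c = "3 / 8 - 21 * \<kappa> * B\<^sup>2"
  have int: "integrable M (\<lambda>\<omega>. (norm (gradient fH (x t \<omega>)))\<^sup>2)" for t
    unfolding fH_def by (rule square_integrable_integrable[OF square_integrable_grad_x])
  have c: "0 < ?c" using kappa by simp
  have S: "0 \<le> ?S" by (intro sum_nonneg) simp
  have gap: "0 \<le> ?gap"
    using cINF_lower[OF fH_bdd_below, of x0] by simp
  have \<kappa>B: "0 \<le> \<kappa> * B\<^sup>2" using \<kappa>_pos by simp
  have split: "(a * u * v + e) / c = a / c * u * v + e / c" for a u v e c :: real
    by (simp add: add_divide_distrib)
  \<comment> \<open>The bound on \<open>\<kappa> B\<^sup>2\<close> makes the denominator \<open>?c\<close> of the claim positive; the coefficients \<open>1/2\<close>,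
      \<open>19/18\<close>, \<open>36\<close> and \<open>\<kappa>\<close> of the summed inequality are sharper than those of the claim.\<close>
  have "?c * ?S \<le> (1 / 2 - \<kappa> * B\<^sup>2) * ?S"
    using \<kappa>B S by (intro mult_right_mono) auto
  also have "\<dots> \<le> 19 / 18 * ?gap / \<gamma>
      + real T * ((36 * L / real h + 36 * \<kappa> * L) * \<gamma> * \<sigma>\<^sup>2 + \<kappa> * G\<^sup>2)"
    using gradient_sum_bound[of T] fH_bdd_below gamma(2) beta H by (simp add: fH_def)
  also have "\<dots> \<le> 9 / 4 * ?gap / \<gamma>
      + real T * ((162 * L / real h + 756 * \<kappa> * L) * \<gamma> * \<sigma>\<^sup>2 + 21 * \<kappa> * G\<^sup>2)"
    using gap \<gamma> L \<kappa>_pos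
    by (intro add_mono mult_left_mono divide_right_mono mult_right_mono) auto
  finally have "(?c * ?S) / (?c * real T) \<le> (9 / 4 * ?gap / \<gamma>
      + real T * ((162 * L / real h + 756 * \<kappa> * L) * \<gamma> * \<sigma>\<^sup>2 + 21 * \<kappa> * G\<^sup>2)) / (?c * real T)"
    using c by (intro divide_right_mono) auto
  also have "\<dots> = 9 * ?gap / (4 * ?c * \<gamma> * real T)
      + ((162 * L / real h + 756 * \<kappa> * L) * \<gamma> * \<sigma>\<^sup>2 + 21 * \<kappa> * G\<^sup>2) / ?c"
    using T by (simp add: add_divide_distrib mult_ac)
  also have "\<dots> = 9 * ?gap / (4 * ?c * \<gamma> * real T)
      + (162 * L / real h + 756 * \<kappa> * L) / ?c * \<gamma> * \<sigma>\<^sup>2 + 21 * \<kappa> * G\<^sup>2 / ?c"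
    by (simp only: split add.assoc)
  finally have "1 / real T * ?S \<le> 9 * ?gap / (4 * ?c * \<gamma> * real T)
      + (162 * L / real h + 756 * \<kappa> * L) / ?c * \<gamma> * \<sigma>\<^sup>2 + 21 * \<kappa> * G\<^sup>2 / ?c"
    using c by simp
  then show ?thesis using int by simp
qed

end
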